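(* Let $B\in\mathbb{C}^{n_1\times\cdots\times n_m}$ be an $m$-mode tensor with partitions $k_\ell=\sum_{s=1}^tk_{\ell s}\le n_\ell$, and let $f$ and $\mathscr{H}_\ell$ ($1\le\ell\le m$) be as defined in the context. Let $\{(P_1^{(j)},\ldots,P_m^{(j)})\}_{j=0}^\infty$ be generated from an initial tuple $P_\ell^{(0)}\in\mathrm{St}(k_\ell,n_\ell)$, $1\le\ell\le m$, by the alternating NPDo iteration: for $j=0,1,2,\ldots$ and, successively, for $\ell=1,\ldots,m$, $P_\ell^{(j+1)}$ is an orthonormal polar factor (any one, if not unique) of $$\widehat{\mathscr{H}}_\ell^{(j)}:=\mathscr{H}_\ell(P_1^{(j+1)},\ldots,P_{\ell-1}^{(j+1)},P_\ell^{(j)},\ldots,P_m^{(j)}).$$ Let $(P_{*1},\ldots,P_{*m})$ be an accumulation point of this sequence, with subsequence $\{(P_1^{(j)},\ldots,P_m^{(j)})\}_{j\in\mathbb{I}}$ converging to it, and let $(\widehat P_{*1},\ldots,\widehat P_{*\,m-1})$ be an accumulation point of $\{(P_1^{(j+1)},\ldots,P_{m-1}^{(j+1)})\}_{j\in\mathbb{I}}$. For $1\le\ell\le m$ put $$\widehat{\mathscr{H}}_{*\ell}:=\mathscr{H}_\ell(\widehat P_{*1},\ldots,\widehat P_{*\,\ell-1},P_{*\ell},\ldots,P_{*m}).$$ Say that $(P_{*1},\ldots,P_{*m})$ satisfies (K) if for all $1\le\ell\le m$, $\mathscr{H}_\ell(P_{*1},\ldots,P_{*m})=P_{*\ell}\Lambda_\ell$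 with $\Lambda_\ell=P_{*\ell}^H\mathscr{H}_\ell(P_{*1},\ldots,P_{*m})\succeq0$. Then: (a) The sequence $\{f(P_1^{(j)},\ldots,P_m^{(j)})\}_{j=0}^\infty$ is monotonically increasing (i.e. nondecreasing) and convergent. (b) For $1\le\ell\le m$, $$\widehat{\mathscr{H}}_{*\ell}=P_{*\ell}\Lambda_{*\ell},\qquad \Lambda_{*\ell}=P_{*\ell}^H\widehat{\mathscr{H}}_{*\ell}\succeq0 .$$ As a result, (K) holds if also $\widehat P_{*\ell}=P_{*\ell}$ for $1\le\ell\le m-1$. (c) If $\mathrm{rank}(\mathscr{H}_\ell(P_{*1},\ldots,P_{*m}))=k_\ell$ for $1\le\ell\le m-1$, then $\widehat P_{*\ell}=P_{*\ell}$ for $1\le\ell\le m-1$, and hence $(P_{*1},\ldots,P_{*m})$ satisfies the KKT condition, in the form (K). (d) If $(P_{*1},\ldots,P_{*m})$ is an isolated accumulation point of $\{(P_1^{(j)},\ldots,P_m^{(j)})\}_{j=0}^\infty$ and $\mathrm{rank}(\mathscr{H}_\ell(P_{*1},\ldots,P_{*m}))=k_\ell$ for $1\le\ell\le m$, then the entire sequence $\{(P_1^{(j)},\ldots,P_m^{(j)})\}_{j=0}^\infty$ converges to $(P_{*1},\ldots,P_{*m})$. (e) For each $1\le\ell\le m$, $$\sum_{j=0}^\infty\sigma_{\min}(\widehat{\mathscr{H}}_\ell^{(j)})\,\big\|\sin\Theta\big(\mathcal{R}(P_\ell^{(j+1)}),\mathcal{R}(P_\ell^{(j)})\big)\big\|_F^2<\infty,$$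 $$\sum_{j=0}^\infty\sigma_{\min}(\widehat{\mathscr{H}}_\ell^{(j)})\,\frac{\big\|\widehat{\mathscr{H}}_\ell^{(j)}-P_\ell^{(j)}\big([P_\ell^{(j)}]^H\widehat{\mathscr{H}}_\ell^{(j)}\big)\big\|_F^2}{\big\|\widehat{\mathscr{H}}_\ell^{(j)}\big\|_F^2}<\infty .$$
   Context: $X^H$ is the conjugate transpose; $A\succeq0$ means Hermitian positive semidefinite; $\mathrm{St}(k,n)=\{P\in\mathbb{C}^{n\times k}:P^HP=I_k\}$; $\mathcal{R}(X)$ is the column space; $\sigma_{\min}(X)$ is the smallest of the $\min\{p,q\}$ singular values of $X\in\mathbb{C}^{p\times q}$; $\Theta(\mathcal{U},\mathcal{V})$ is the diagonal matrix of canonical (principal) angles between two subspaces of equal dimension. An orthonormal polar factor of $H\in\mathbb{C}^{n\times k}$ ($k\le n$) is a $Q\in\mathrm{St}(k,n)$ with $H=Q\Lambda$ for some $\Lambda\succeq0$ (a polar decomposition). Terms of the second series in (e) with $\widehat{\mathscr{H}}_\ell^{(j)}=0$ are read as $0$. Let $m\ge 2$, $t\ge1$. For an $m$-mode tensor $B=[b_{i_1\cdots i_m}]\in\mathbb{C}^{n_1\times\cdots\times n_m}$: $\|B\|_F=(\sum|b_{i_1\cdots i_m}|^2)^{1/2}$. For $X=[x_{ij}]\in\mathbb{C}^{k\times n_\ell}$, the $\ell$th mode-multiplication $B\times_\ell X\in\mathbb{C}^{n_1\times\cdots\times n_{\ell-1}\times k\times n_{\ell+1}\times\cdots\times n_m}$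 has entries $(B\times_\ell X)_{(i_1\cdots i_m)}=\sum_{j=1}^{n_\ell}x_{i_\ell j}\,b_{i_1\cdots i_{\ell-1}\,j\,i_{\ell+1}\cdots i_m}$. The $\ell$th unfolding $B_{\mathrm{ufd},\ell}\in\mathbb{C}^{n_\ell\times (n_1\cdots n_m/n_\ell)}$ is the matrix whose columns are the vectors obtained by letting the $\ell$th index run from $1$ to $n_\ell$ with all other indices fixed (columns arranged in any fixed order). Partitions $k_\ell=\sum_{s=1}^tk_{\ell s}\le n_\ell$ (integers $k_{\ell s}\ge1$), $1\le\ell\le m$, are given. Each $P_\ell\in\mathbb{C}^{n_\ell\times k_\ell}$ is partitioned columnwise as $P_\ell=[P_{\ell1},\ldots,P_{\ell t}]$ with $P_{\ell s}\in\mathbb{C}^{n_\ell\times k_{\ell s}}$. The objective, to be maximized over $P_\ell\in\mathrm{St}(k_\ell,n_\ell)$, is $$f(P_1,\ldots,P_m)=\sum_{s=1}^t\big\|B\times_1P_{1s}^H\times_2P_{2s}^H\cdots\times_mP_{ms}^H\big\|_F^2,$$ i.e. the squared Frobenius norm of the block-diagonal part (diagonal blocks of sizes $k_{1s}\times\cdots\times k_{ms}$, $1\le s\le t$) of $B\times_1P_1^H\cdots\times_mP_m^H$. For $1\le\ell\le m$, $1\le s\le t$, let $C_{\ell s}$ be the $\ell$th unfolding of the tensor obtained from $B$ by mode-multiplications $\times_iP_{is}^H$ for all $i\ne\ell$, and $H_{\ell s}=C_{\ell s}C_{\ell s}^H\in\mathbb{C}^{n_\ell\times n_\ell}$ (depending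 on $P_{is}$, $i\neq \ell$). The partial Euclidean gradient of $f$ with respect to $P_\ell$ (with respect to the real inner product $\langle X,Y\rangle=\Re\,\mathrm{tr}(Y^HX)$) is $$\mathscr{H}_\ell(P_1,\ldots,P_m)=2\,[H_{\ell1}P_{\ell1},\ldots,H_{\ell t}P_{\ell t}]\in\mathbb{C}^{n_\ell\times k_\ell}.$$ The KKT condition of the maximization problem is: $\mathscr{H}_\ell(P_1,\ldots,P_m)=P_\ell\Lambda_\ell$, $P_\ell\in\mathrm{St}(k_\ell,n_\ell)$, $\Lambda_\ell=\Lambda_\ell^H\in\mathbb{C}^{k_\ell\times k_\ell}$ for all $\ell$. *)

theory Defs
  imports
    Complex_Main
    "HOL-Library.Multiset"
    "Jordan_Normal_Form.Schur_Decomposition"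
    "Jordan_Normal_Form.DL_Rank"
begin

text \<open>
  Conventions: modes, blocks and indices are counted from 0, so a mode is some \<open>l < m\<close> and a
  block some \<open>s < t\<close>. A tuple of matrices is a function \<open>P\<close> with \<open>P l\<close> the matrix for mode
  \<open>l\<close>; its values at \<open>l \<ge> m\<close> are irrelevant. \<open>k l s\<close> is the width of block \<open>s\<close> in mode \<open>l\<close>.
\<close>

section \<open>Matrices\<close>

definition frob_norm :: "complex mat \<Rightarrow> real" where
  "frob_norm A = sqrt (\<Sum>i<dim_row A. \<Sum>j<dim_col A. (cmod (A $$ (i, j)))\<^sup>2)"

definition hermitian_mat :: "complex mat \<Rightarrow> bool" where
  "hermitian_mat A \<longleftrightarrow> square_mat A \<and> mat_adjoint A = A"

definition psd_mat :: "complex mat \<Rightarrow> bool" where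
  "psd_mat A \<longleftrightarrow> hermitian_mat A \<and>
     (\<forall>v \<in> carrier_vec (dim_row A). 0 \<le> Re ((A *\<^sub>v v) \<bullet>c v))"

definition stiefel :: "nat \<Rightarrow> nat \<Rightarrow> complex mat set" where
  "stiefel k n = {P \<in> carrier_mat n k. mat_adjoint P * P = 1\<^sub>m k}"

definition orthonormal_polar_factor :: "complex mat \<Rightarrow> complex mat \<Rightarrow> bool" where
  "orthonormal_polar_factor Q H \<longleftrightarrow> Q \<in> stiefel (dim_col H) (dim_row H) \<and>
     (\<exists>L \<in> carrier_mat (dim_col H) (dim_col H). psd_mat L \<and> H = Q * L)"

text \<open>The smaller of the two Gram matrices is used, so that a \<open>p \<times> q\<close> matrix has exactly
  \<open>min p q\<close> singular values, counted with multiplicity.\<close>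

definition singular_values :: "complex mat \<Rightarrow> real multiset" where
  "singular_values X = image_mset (\<lambda>e. sqrt (Re e))
     (proots (char_poly
       (if dim_col X \<le> dim_row X then mat_adjoint X * X else X * mat_adjoint X)))"

definition sigma_min :: "complex mat \<Rightarrow> real" where
  "sigma_min X = Min (set_mset (singular_values X))"

definition orthonormal_basis_mat :: "nat \<Rightarrow> complex vec set \<Rightarrow> complex mat \<Rightarrow> bool" where
  "orthonormal_basis_mat n S U \<longleftrightarrow> U \<in> stiefel (dim_col U) n \<and> vec_space.col_space n U = S"

text \<open>The canonical angles are the arccosines of the singular values of \<open>U\<^sup>H V\<close>, where the
  columns of \<open>U\<close> and \<open>V\<close> are orthonormal bases of the two subspaces of \<open>\<complex>\<^sup>n\<close>; they
  do not depend on the bases chosen. The diagonal of \<open>\<Theta>\<close> is put in increasing order.\<close>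

definition canonical_angles :: "nat \<Rightarrow> complex vec set \<Rightarrow> complex vec set \<Rightarrow> real multiset" where
  "canonical_angles n S T =
     (let U = (SOME U. orthonormal_basis_mat n S U);
          V = (SOME V. orthonormal_basis_mat n T V)
      in image_mset arccos (singular_values (mat_adjoint U * V)))"

definition sin_Theta :: "nat \<Rightarrow> complex vec set \<Rightarrow> complex vec set \<Rightarrow> complex mat" where
  "sin_Theta n S T =
     (let ths = sorted_list_of_multiset (canonical_angles n S T)
      in mat_diag (length ths) (\<lambda>i. complex_of_real (sin (ths ! i))))"

section \<open>Convergence and accumulation points of tuples of matrices\<close>

definition mat_LIMSEQ :: "(nat \<Rightarrow> complex mat) \<Rightarrow> complex mat \<Rightarrow> bool" where
  "mat_LIMSEQ X A \<longleftrightarrow> (\<forall>j. X j \<in> carrier_mat (dim_row A) (dim_col A)) \<and>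
     (\<lambda>j. frob_norm (X j - A)) \<longlonglongrightarrow> 0"

definition tuple_LIMSEQ ::
  "nat \<Rightarrow> (nat \<Rightarrow> nat \<Rightarrow> complex mat) \<Rightarrow> (nat \<Rightarrow> complex mat) \<Rightarrow> bool" where
  "tuple_LIMSEQ m X A \<longleftrightarrow> (\<forall>l<m. mat_LIMSEQ (\<lambda>j. X j l) (A l))"

definition accumulation_point ::
  "nat \<Rightarrow> (nat \<Rightarrow> nat \<Rightarrow> complex mat) \<Rightarrow> (nat \<Rightarrow> complex mat) \<Rightarrow> bool" where
  "accumulation_point m X A \<longleftrightarrow>
     (\<exists>r :: nat \<Rightarrow> nat. strict_mono r \<and> tuple_LIMSEQ m (\<lambda>i. X (r i)) A)"

definition isolated_accumulation_point ::
  "nat \<Rightarrow> (nat \<Rightarrow> nat \<Rightarrow> complex mat) \<Rightarrow> (nat \<Rightarrow> complex mat) \<Rightarrow> bool" where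
  "isolated_accumulation_point m X A \<longleftrightarrow> accumulation_point m X A \<and>
     (\<exists>\<epsilon>>0. \<forall>Q. accumulation_point m X Q \<longrightarrow> (\<forall>l<m. frob_norm (Q l - A l) < \<epsilon>) \<longrightarrow>
        (\<forall>l<m. Q l = A l))"

section \<open>Tensors\<close>

text \<open>A tensor consists of the list of its dimensions (one per mode) and its entries, indexed by
  lists; only the entries at multi-indices within the dimensions matter.\<close>

datatype ctensor = Tensor (tdims: "nat list") (tentry: "nat list \<Rightarrow> complex")

definition multi_indices :: "nat list \<Rightarrow> nat list list" where
  "multi_indices ds = product_lists (map (\<lambda>d. [0..<d]) ds)"

definition tensor_norm :: "ctensor \<Rightarrow> real" where
  "tensor_norm T = sqrt (\<Sum>is \<in> set (multi_indices (tdims T)). (cmod (tentry T is))\<^sup>2)"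

definition mode_mult :: "nat \<Rightarrow> complex mat \<Rightarrow> ctensor \<Rightarrow> ctensor" where
  "mode_mult l X T = Tensor ((tdims T)[l := dim_row X])
     (\<lambda>is. \<Sum>j < tdims T ! l. X $$ (is ! l, j) * tentry T (is[l := j]))"

text \<open>The columns are indexed by the multi-indices whose \<open>l\<close>th entry is 0, in lexicographic
  order.\<close>

definition unfolding_mat :: "nat \<Rightarrow> ctensor \<Rightarrow> complex mat" where
  "unfolding_mat l T =
     (let cs = multi_indices ((tdims T)[l := 1])
      in mat (tdims T ! l) (length cs) (\<lambda>(i, c). tentry T ((cs ! c)[l := i])))"

section \<open>The objective, its partial gradients and the KKT condition\<close>

definition col_block :: "(nat \<Rightarrow> nat) \<Rightarrow> nat \<Rightarrow> complex mat \<Rightarrow> complex mat" where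
  "col_block w s P = mat (dim_row P) (w s) (\<lambda>(i, c). P $$ (i, (\<Sum>r<s. w r) + c))"

definition hconcat :: "nat \<Rightarrow> complex mat list \<Rightarrow> complex mat" where
  "hconcat n Ms = mat_of_cols n (concat (map cols Ms))"

definition mode_mults ::
  "(nat \<Rightarrow> nat \<Rightarrow> nat) \<Rightarrow> nat \<Rightarrow> (nat \<Rightarrow> complex mat) \<Rightarrow> nat list \<Rightarrow> ctensor \<Rightarrow> ctensor" where
  "mode_mults k s P ls T =
     fold (\<lambda>l. mode_mult l (mat_adjoint (col_block (k l) s (P l)))) ls T"

definition objective ::
  "nat \<Rightarrow> (nat \<Rightarrow> nat \<Rightarrow> nat) \<Rightarrow> ctensor \<Rightarrow> (nat \<Rightarrow> complex mat) \<Rightarrow> real" where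
  "objective t k B P =
     (\<Sum>s<t. (tensor_norm (mode_mults k s P [0..<length (tdims B)] B))\<^sup>2)"

definition C_mat ::
  "(nat \<Rightarrow> nat \<Rightarrow> nat) \<Rightarrow> ctensor \<Rightarrow> (nat \<Rightarrow> complex mat) \<Rightarrow> nat \<Rightarrow> nat \<Rightarrow> complex mat" where
  "C_mat k B P l s =
     unfolding_mat l (mode_mults k s P (filter (\<lambda>i. i \<noteq> l) [0..<length (tdims B)]) B)"

definition H_mat ::
  "(nat \<Rightarrow> nat \<Rightarrow> nat) \<Rightarrow> ctensor \<Rightarrow> (nat \<Rightarrow> complex mat) \<Rightarrow> nat \<Rightarrow> nat \<Rightarrow> complex mat" where
  "H_mat k B P l s = C_mat k B P l s * mat_adjoint (C_mat k B P l s)"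

definition grad ::
  "nat \<Rightarrow> (nat \<Rightarrow> nat \<Rightarrow> nat) \<Rightarrow> ctensor \<Rightarrow> nat \<Rightarrow> (nat \<Rightarrow> complex mat) \<Rightarrow> complex mat" where
  "grad t k B l P = 2 \<cdot>\<^sub>m
     hconcat (tdims B ! l) (map (\<lambda>s. H_mat k B P l s * col_block (k l) s (P l)) [0..<t])"

text \<open>The tuple \<open>(Q 0, \<dots>, Q (l - 1), P l, P (l + 1), \<dots>)\<close>.\<close>

definition mixed :: "nat \<Rightarrow> (nat \<Rightarrow> complex mat) \<Rightarrow> (nat \<Rightarrow> complex mat) \<Rightarrow> nat \<Rightarrow> complex mat" where
  "mixed l Q P = (\<lambda>i. if i < l then Q i else P i)"

definition KKT_condition ::
  "nat \<Rightarrow> (nat \<Rightarrow> nat \<Rightarrow> nat) \<Rightarrow> ctensor \<Rightarrow> (nat \<Rightarrow> complex mat) \<Rightarrow> bool" where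
  "KKT_condition t k B P \<longleftrightarrow> (\<forall>l < length (tdims B).
     P l \<in> stiefel (\<Sum>s<t. k l s) (tdims B ! l) \<and>
     (\<exists>L \<in> carrier_mat (\<Sum>s<t. k l s) (\<Sum>s<t. k l s).
        hermitian_mat L \<and> grad t k B l P = P l * L))"

definition condition_K ::
  "nat \<Rightarrow> (nat \<Rightarrow> nat \<Rightarrow> nat) \<Rightarrow> ctensor \<Rightarrow> (nat \<Rightarrow> complex mat) \<Rightarrow> bool" where
  "condition_K t k B P \<longleftrightarrow> (\<forall>l < length (tdims B).
     let G = grad t k B l P; L = mat_adjoint (P l) * G
     in G = P l * L \<and> psd_mat L)"

end

theory Submission
  imports Defs "HOL-Analysis.L2_Norm" "HOL-Library.Infinite_Set"
begin

text \<open>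
  Fix all factors but \<open>P\<close> (the old one) and let \<open>H = Q L\<close> be the polar decomposition of the
  partial gradient, \<open>Q\<close> being the new factor. The objective is a convex quadratic function of
  \<open>P\<close>, so it grows by at least \<open>Re \<langle>H, Q - P\<rangle>\<close>, and since \<open>Q\<close> and \<open>P\<close>
  have orthonormal columns this number is \<open>\<langle>(Q - P) L, Q - P\<rangle> / 2 \<ge> 0\<close>. The increments
  are summable because the objective is bounded. Two estimates of this quadratic form give everything else.

  From below it is at least \<open>\<sigma>\<^sub>m\<^sub>i\<^sub>n(H) \<parallel>Q - P\<parallel>\<^sup>2\<close>, while
  \<open>\<parallel>sin \<Theta>\<parallel> = \<parallel>(I - P P\<^sup>H) Q\<parallel> \<le> \<parallel>Q - P\<parallel>\<close>; this proves the two series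
  convergent. Moreover \<open>\<parallel>(Q - P) L\<parallel>\<^sup>2 \<le> \<parallel>L\<parallel> \<langle>(Q - P) L, Q - P\<rangle>\<close>, so
  \<open>(Q - P) L \<longlonglongrightarrow> 0\<close>. Along a subsequence on which \<open>P\<close> and \<open>H\<close> converge this
  identifies the limit of \<open>H\<close>, and, if that limit has full column rank, \<open>L\<close> has an
  invertible limit, so that \<open>Q - P \<longlonglongrightarrow> 0\<close>.
\<close>

section \<open>Complex matrices and the Frobenius inner product\<close>

text \<open>Two obstacles shape the limit arguments. Where the gradient loses rank, its polar factor
  is neither unique nor continuous, so passing to the limit in \<open>H = Q L\<close> would only
  give a factorisation through some limit of \<open>Q\<close>. The old factor \<open>P\<close>,
  whose limit is known, takes the place of \<open>Q\<close>: from \<open>H = P L + (Q - P) L\<close>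
  with \<open>(Q - P) L\<close> tending to 0, the factor \<open>L\<close> is recovered as the limit
  of \<open>P^H H\<close>, and positive semidefiniteness passes to that limit. Secondly, the
  gradient for mode \<open>l\<close> is taken at a mixed tuple, new below \<open>l\<close> and old
  from \<open>l\<close> on. Its limit is known to be the gradient at the accumulation point once the
  new factors below \<open>l\<close> converge to the same limits as the old ones. Hence the
  induction over modes in the full rank case: each mode settled this way makes the next rank
  hypothesis applicable. Full rank in the last mode as well carries the whole next tuple along,
  which is what the argument for an isolated accumulation point needs.\<close>

lemma dim_mat_adjoint [simp]:
  "dim_row (mat_adjoint A) = dim_col A" "dim_col (mat_adjoint A) = dim_row A"
  by (simp_all add: mat_adjoint_def)

lemma mat_adjoint_carrier [simp]: "A \<in> carrier_mat n k \<Longrightarrow> mat_adjoint A \<in> carrier_mat k n"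
  by auto

lemma mat_adjoint_index [simp]:
  fixes A :: "complex mat"
  shows "i < dim_col A \<Longrightarrow> j < dim_row A \<Longrightarrow> mat_adjoint A $$ (i, j) = cnj (A $$ (j, i))"
  by (simp add: mat_adjoint_def mat_of_rows_def)

lemma mat_adjoint_adjoint [simp]: "mat_adjoint (mat_adjoint A) = (A :: complex mat)"
  by (rule eq_matI) auto

lemma mat_adjoint_one [simp]: "mat_adjoint (1\<^sub>m n) = (1\<^sub>m n :: complex mat)"
  by (rule eq_matI) auto

lemma index_mult_mat_sum [simp]:
  assumes "i < dim_row A" "j < dim_col B" "dim_col A = dim_row B"
  shows "(A * B) $$ (i, j) = (\<Sum>a<dim_row B. A $$ (i, a) * B $$ (a, j))"
  using assms by (simp add: scalar_prod_def lessThan_atLeast0)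

declare index_mult_mat(1) [simp del]

lemma mat_adjoint_mult:
  fixes A B :: "complex mat"
  assumes "dim_col A = dim_row B"
  shows "mat_adjoint (A * B) = mat_adjoint B * mat_adjoint A"
  using assms by (intro eq_matI) (auto simp: index_mult_mat_sum mult.commute intro!: sum.cong)

lemma mat_adjoint_smult: "mat_adjoint (c \<cdot>\<^sub>m A) = cnj c \<cdot>\<^sub>m mat_adjoint (A :: complex mat)"
  by (rule eq_matI) auto

lemma mat_adjoint_diff:
  fixes A B :: "complex mat"
  assumes "A \<in> carrier_mat n k" "B \<in> carrier_mat n k"
  shows "mat_adjoint (A - B) = mat_adjoint A - mat_adjoint B"
  using assms by (intro eq_matI) auto

text \<open>This is \<open>tr (B^H A)\<close>, written entrywise. Its real part is the inner product
  for which \<open>grad\<close> is the Euclidean gradient.\<close>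

definition mat_inner :: "complex mat \<Rightarrow> complex mat \<Rightarrow> complex" where
  "mat_inner A B = (\<Sum>i<dim_row A. \<Sum>j<dim_col A. A $$ (i, j) * cnj (B $$ (i, j)))"

lemma frob_norm_sq: "(frob_norm A)\<^sup>2 = (\<Sum>i<dim_row A. \<Sum>j<dim_col A. (cmod (A $$ (i, j)))\<^sup>2)"
  unfolding frob_norm_def by (simp add: sum_nonneg)

lemma frob_norm_nonneg [simp]: "0 \<le> frob_norm A"
  unfolding frob_norm_def by (simp add: sum_nonneg)

lemma mat_inner_self: "mat_inner A A = of_real ((frob_norm A)\<^sup>2)"
  unfolding mat_inner_def frob_norm_sq of_real_sum
  by (simp add: complex_norm_square del: of_real_power flip: of_real_power)

lemma Re_mat_inner_self: "Re (mat_inner A A) = (frob_norm A)\<^sup>2"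
  by (simp add: mat_inner_self)

lemma mat_inner_commute:
  assumes "A \<in> carrier_mat n k" "B \<in> carrier_mat n k"
  shows "mat_inner B A = cnj (mat_inner A B)"
  using assms by (simp add: mat_inner_def mult.commute)

lemma mat_inner_diff_left:
  assumes "A \<in> carrier_mat n k" "B \<in> carrier_mat n k"
  shows "mat_inner (A - B) C = mat_inner A C - mat_inner B C"
  using assms by (simp add: mat_inner_def left_diff_distrib sum_subtractf)

lemma mat_inner_diff_right:
  assumes "A \<in> carrier_mat n k" "B \<in> carrier_mat n k" "C \<in> carrier_mat n k"
  shows "mat_inner C (A - B) = mat_inner C A - mat_inner C B"
  using assms by (simp add: mat_inner_def right_diff_distrib sum_subtractf)

lemma mat_inner_smult_left: "mat_inner (c \<cdot>\<^sub>m A) B = c * mat_inner A B"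
  by (simp add: mat_inner_def sum_distrib_left mult.assoc)

lemma mat_inner_smult_right:
  assumes "A \<in> carrier_mat n k" "B \<in> carrier_mat n k"
  shows "mat_inner A (c \<cdot>\<^sub>m B) = cnj c * mat_inner A B"
  using assms by (simp add: mat_inner_def sum_distrib_left mult_ac)

lemma mat_inner_mult_right:
  assumes "A \<in> carrier_mat n k" "C \<in> carrier_mat k p" "B \<in> carrier_mat n p"
  shows "mat_inner (A * C) B = mat_inner A (B * mat_adjoint C)"
proof -
  have "mat_inner (A * C) B
      = (\<Sum>i<n. \<Sum>j<p. \<Sum>a<k. A $$ (i, a) * C $$ (a, j) * cnj (B $$ (i, j)))"
    using assms by (simp add: mat_inner_def index_mult_mat_sum sum_distrib_right)
  also have "\<dots> = (\<Sum>i<n. \<Sum>a<k. \<Sum>j<p. A $$ (i, a) * C $$ (a, j) * cnj (B $$ (i, j)))"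
    by (intro sum.cong refl sum.swap)
  also have "\<dots> = mat_inner A (B * mat_adjoint C)"
    using assms
    by (simp add: mat_inner_def index_mult_mat_sum sum_distrib_left mult_ac)
  finally show ?thesis .
qed

lemma mat_inner_mult_left:
  assumes "A \<in> carrier_mat k p" "C \<in> carrier_mat n k" "B \<in> carrier_mat n p"
  shows "mat_inner (C * A) B = mat_inner A (mat_adjoint C * B)"
proof -
  have "mat_inner (C * A) B
      = (\<Sum>i<n. \<Sum>j<p. \<Sum>a<k. C $$ (i, a) * A $$ (a, j) * cnj (B $$ (i, j)))"
    using assms by (simp add: mat_inner_def index_mult_mat_sum sum_distrib_right)
  also have "\<dots> = (\<Sum>i<n. \<Sum>a<k. \<Sum>j<p. C $$ (i, a) * A $$ (a, j) * cnj (B $$ (i, j)))"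
    by (intro sum.cong refl sum.swap)
  also have "\<dots> = (\<Sum>a<k. \<Sum>i<n. \<Sum>j<p. C $$ (i, a) * A $$ (a, j) * cnj (B $$ (i, j)))"
    by (rule sum.swap)
  also have "\<dots> = (\<Sum>a<k. \<Sum>j<p. \<Sum>i<n. C $$ (i, a) * A $$ (a, j) * cnj (B $$ (i, j)))"
    by (intro sum.cong refl sum.swap)
  also have "\<dots> = mat_inner A (mat_adjoint C * B)"
    using assms
    by (simp add: mat_inner_def index_mult_mat_sum sum_distrib_left mult_ac)
  finally show ?thesis .
qed

lemma frob_norm_adjoint: "frob_norm (mat_adjoint A) = frob_norm A"
proof -
  have "(frob_norm (mat_adjoint A))\<^sup>2 = (frob_norm A)\<^sup>2"
    unfolding frob_norm_sq by (subst sum.swap) auto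
  then show ?thesis by simp
qed

lemma frob_norm_L2_set:
  "frob_norm A = L2_set (\<lambda>(i, j). cmod (A $$ (i, j))) ({..<dim_row A} \<times> {..<dim_col A})"
  unfolding frob_norm_def L2_set_def by (simp add: sum.cartesian_product split_def)

lemma mat_inner_bound:
  assumes "A \<in> carrier_mat n k" "B \<in> carrier_mat n k"
  shows "cmod (mat_inner A B) \<le> frob_norm A * frob_norm B"
proof -
  have "cmod (mat_inner A B)
      = cmod (\<Sum>(i, j)\<in>{..<n} \<times> {..<k}. A $$ (i, j) * cnj (B $$ (i, j)))"
    using assms by (simp add: mat_inner_def sum.cartesian_product)
  also have "\<dots> \<le> (\<Sum>x\<in>{..<n} \<times> {..<k}. \<bar>cmod (A $$ x)\<bar> * \<bar>cmod (B $$ x)\<bar>)"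
    by (rule order_trans[OF norm_sum]) (simp add: split_def norm_mult)
  also have "\<dots> \<le> frob_norm A * frob_norm B"
    using L2_set_mult_ineq[of "\<lambda>x. cmod (A $$ x)" "\<lambda>x. cmod (B $$ x)" "{..<n} \<times> {..<k}"] assms
    by (simp add: frob_norm_L2_set split_def)
  finally show ?thesis .
qed

lemma frob_norm_mult_le:
  assumes "A \<in> carrier_mat n k" "B \<in> carrier_mat k p"
  shows "frob_norm (A * B) \<le> frob_norm A * frob_norm B"
proof (rule power2_le_imp_le)
  have *: "(cmod ((A * B) $$ (i, j)))\<^sup>2
      \<le> (\<Sum>a<k. (cmod (A $$ (i, a)))\<^sup>2) * (\<Sum>a<k. (cmod (B $$ (a, j)))\<^sup>2)" if "i < n" "j < p" for i j
  proof -
    have "cmod ((A * B) $$ (i, j)) \<le> (\<Sum>a<k. \<bar>cmod (A $$ (i, a))\<bar> * \<bar>cmod (B $$ (a, j))\<bar>)"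
      using assms that by (auto simp: index_mult_mat_sum norm_mult intro: sum_norm_le)
    also have "\<dots> \<le> L2_set (\<lambda>a. cmod (A $$ (i, a))) {..<k} * L2_set (\<lambda>a. cmod (B $$ (a, j))) {..<k}"
      by (rule L2_set_mult_ineq)
    finally have "(cmod ((A * B) $$ (i, j)))\<^sup>2
        \<le> (L2_set (\<lambda>a. cmod (A $$ (i, a))) {..<k} * L2_set (\<lambda>a. cmod (B $$ (a, j))) {..<k})\<^sup>2"
      by (rule power_mono) simp
    then show ?thesis
      by (simp add: L2_set_def power_mult_distrib sum_nonneg)
  qed
  have "(frob_norm (A * B))\<^sup>2
      \<le> (\<Sum>i<n. \<Sum>j<p. (\<Sum>a<k. (cmod (A $$ (i, a)))\<^sup>2) * (\<Sum>a<k. (cmod (B $$ (a, j)))\<^sup>2))"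
    unfolding frob_norm_sq using assms * by (auto intro!: sum_mono)
  also have "\<dots> = (\<Sum>i<n. \<Sum>a<k. (cmod (A $$ (i, a)))\<^sup>2) * (\<Sum>j<p. \<Sum>a<k. (cmod (B $$ (a, j)))\<^sup>2)"
    by (simp add: sum_product)
  also have "\<dots> = (frob_norm A * frob_norm B)\<^sup>2"
    unfolding frob_norm_sq power_mult_distrib using assms
    sum.swap[of "\<lambda>j a. (cmod (B $$ (a, j)))\<^sup>2" "{..<k}" "{..<p}"] by simp
  finally show "(frob_norm (A * B))\<^sup>2 \<le> (frob_norm A * frob_norm B)\<^sup>2" .
qed simp

lemma frob_norm_eq_0_iff:
  assumes "A \<in> carrier_mat n k"
  shows "frob_norm A = 0 \<longleftrightarrow> A = 0\<^sub>m n k"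
proof
  assume "frob_norm A = 0"
  then have "(\<Sum>i<n. \<Sum>j<k. (cmod (A $$ (i, j)))\<^sup>2) = 0"
    using assms frob_norm_sq[of A] by simp
  then show "A = 0\<^sub>m n k"
    using assms by (intro eq_matI) (auto simp: sum_nonneg_eq_0_iff sum_nonneg)
qed (simp add: frob_norm_def)

lemma norm_entry_le_frob_norm:
  assumes "i < dim_row A" "j < dim_col A"
  shows "cmod (A $$ (i, j)) \<le> frob_norm A"
  using member_le_L2_set[of "{..<dim_row A} \<times> {..<dim_col A}" "(i, j)" "\<lambda>(i, j). cmod (A $$ (i, j))"] assms
  by (simp add: frob_norm_L2_set)

section \<open>Matrices with orthonormal columns and their projections\<close>

lemma stiefel_iff: "P \<in> stiefel k n \<longleftrightarrow> P \<in> carrier_mat n k \<and> mat_adjoint P * P = 1\<^sub>m k"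
  by (simp add: stiefel_def)

lemma stiefel_adjoint_mult_mult:
  assumes "P \<in> stiefel k n" "X \<in> carrier_mat k p"
  shows "mat_adjoint P * (P * X) = X"
  using assms assoc_mult_mat[of "mat_adjoint P" k n P k X p] by (simp add: stiefel_iff)

lemma frob_norm_stiefel_mult:
  assumes "P \<in> stiefel k n" "X \<in> carrier_mat k p"
  shows "frob_norm (P * X) = frob_norm X"
proof -
  have "mat_inner (P * X) (P * X) = mat_inner X X"
    using assms by (subst mat_inner_mult_left[of _ k p _ n])
      (auto simp: stiefel_iff stiefel_adjoint_mult_mult[OF assms])
  then have "(frob_norm (P * X))\<^sup>2 = (frob_norm X)\<^sup>2"
    by (simp flip: Re_mat_inner_self)
  then show ?thesis by simp
qed

lemma frob_norm_one: "(frob_norm (1\<^sub>m k))\<^sup>2 = real k"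
  by (simp add: frob_norm_sq if_distrib[of cmod] if_distrib[of "\<lambda>x. x\<^sup>2"] cong: if_cong)

lemma frob_norm_stiefel:
  assumes "P \<in> stiefel k n"
  shows "(frob_norm P)\<^sup>2 = real k"
  using frob_norm_stiefel_mult[OF assms, of "1\<^sub>m k" k] assms right_mult_one_mat[of P n k] frob_norm_one[of k]
  by (simp add: stiefel_iff)

text \<open>Pythagoras for the orthogonal projector \<open>P * mat_adjoint P\<close> onto the column
  space of \<open>P\<close>.\<close>

lemma frob_norm_projection:
  assumes P: "P \<in> stiefel k n" and X: "X \<in> carrier_mat n p"
  shows "(frob_norm (X - P * (mat_adjoint P * X)))\<^sup>2
    = (frob_norm X)\<^sup>2 - (frob_norm (mat_adjoint P * X))\<^sup>2"
proof -
  let ?Y = "mat_adjoint P * X"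
  have c: "P \<in> carrier_mat n k" "?Y \<in> carrier_mat k p" "P * ?Y \<in> carrier_mat n p"
    "mat_adjoint P \<in> carrier_mat k n"
    using P X by (auto simp: stiefel_iff)
  have 1: "mat_inner (P * ?Y) X = mat_inner ?Y ?Y"
    using c X by (subst mat_inner_mult_left[of _ k p _ n]) auto
  have 2: "mat_inner X (P * ?Y) = mat_inner ?Y ?Y"
    using 1 mat_inner_commute[OF c(3) X] by (simp add: mat_inner_self)
  have 3: "mat_inner (P * ?Y) (P * ?Y) = mat_inner ?Y ?Y"
    using frob_norm_stiefel_mult[OF P c(2)] by (simp add: mat_inner_self)
  have "mat_inner (X - P * ?Y) (X - P * ?Y) = mat_inner X X - mat_inner ?Y ?Y"
    using mat_inner_diff_left[OF X c(3), of "X - P * ?Y"] mat_inner_diff_right[OF X c(3) X]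
      mat_inner_diff_right[OF X c(3) c(3)] by (simp add: 1 2 3)
  then have "Re (mat_inner (X - P * ?Y) (X - P * ?Y)) = Re (mat_inner X X) - Re (mat_inner ?Y ?Y)"
    by simp
  then show ?thesis by (simp only: Re_mat_inner_self)
qed

lemma full_rank_kernel:
  fixes A :: "complex mat"
  assumes A: "A \<in> carrier_mat n c" "vec_space.rank n A = c"
    and v: "v \<in> carrier_vec c" "A *\<^sub>v v = 0\<^sub>v n"
  shows "v = 0\<^sub>v c"
proof -
  interpret vec_space "TYPE(complex)" n .
  \<comment> \<open>Independence of the set of columns cannot see a repeated column. A repetition
    would leave fewer than \<open>c\<close> distinct columns, while the rank is the size of a
    maximal independent subset of them.\<close>
  have "distinct (cols A)"
  proof (rule ccontr)
    assume "\<not> distinct (cols A)"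
    then have "card (set (cols A)) < c"
      using A(1) card_distinct[of "cols A"] card_length[of "cols A"] by fastforce
    obtain S where S: "maximal S (\<lambda>T. T \<subseteq> set (cols A) \<and> lin_indpt T)"
      using maximal_exists[of "(\<lambda>T. T \<subseteq> set (cols A) \<and> lin_indpt T)" "card (set (cols A))" "{}"]
      by (meson List.finite_set card_mono empty_iff empty_subsetI finite_lin_indpt2 rev_finite_subset)
    then have "card S \<le> card (set (cols A))" by (simp add: card_mono maximal_def)
    then show False
      using rank_card_indpt[OF A(1) S] A(2) \<open>card (set (cols A)) < c\<close> by simp
  qed
  then show ?thesis
    using full_rank_lin_indpt[OF A] lin_depI[OF A(1) v(1) _ v(2)] by blast
qed

section \<open>Positive semidefinite matrices\<close>

lemma psd_matD:
  assumes "psd_mat L"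
  shows "L \<in> carrier_mat (dim_row L) (dim_row L)" "mat_adjoint L = L"
  using assms by (auto simp: psd_mat_def hermitian_mat_def)

lemma mult_mat_vec_conj_scalar_prod:
  fixes A :: "complex mat"
  assumes "A \<in> carrier_mat k k" "v \<in> carrier_vec k"
  shows "(A *\<^sub>v v) \<bullet>c v = (\<Sum>i<k. \<Sum>j<k. A $$ (i, j) * v $ j * cnj (v $ i))"
  using assms
  by (simp add: scalar_prod_def sum_distrib_left sum_distrib_right mult_ac lessThan_atLeast0 mult_mat_vec_def)

text \<open>Test vectors are plain functions here, so that a row of a matrix can be substituted
  directly and the condition passes to limits entry by entry.\<close>

lemma psd_mat_iff:
  assumes "L \<in> carrier_mat k k"
  shows "psd_mat L \<longleftrightarrow> mat_adjoint L = L \<and>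
    (\<forall>x :: nat \<Rightarrow> complex. 0 \<le> Re (\<Sum>i<k. \<Sum>j<k. L $$ (i, j) * x j * cnj (x i)))"
    (is "_ \<longleftrightarrow> _ \<and> (\<forall>x. 0 \<le> ?q x)")
proof -
  have "(\<forall>v\<in>carrier_vec k. 0 \<le> Re ((L *\<^sub>v v) \<bullet>c v)) \<longleftrightarrow> (\<forall>x. 0 \<le> ?q x)"
  proof
    assume v: "\<forall>v\<in>carrier_vec k. 0 \<le> Re ((L *\<^sub>v v) \<bullet>c v)"
    show "\<forall>x. 0 \<le> ?q x"
    proof
      fix x :: "nat \<Rightarrow> complex"
      show "0 \<le> ?q x"
        using v[rule_format, of "vec k x"] mult_mat_vec_conj_scalar_prod[OF assms, of "vec k x"] by simp
    qed
  next
    assume x: "\<forall>x. 0 \<le> ?q x"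
    show "\<forall>v\<in>carrier_vec k. 0 \<le> Re ((L *\<^sub>v v) \<bullet>c v)"
    proof
      fix v :: "complex vec" assume "v \<in> carrier_vec k"
      then show "0 \<le> Re ((L *\<^sub>v v) \<bullet>c v)"
        using x[rule_format, of "\<lambda>i. v $ i"] mult_mat_vec_conj_scalar_prod[OF assms, of v] by simp
    qed
  qed
  then show ?thesis
    using assms by (auto simp: psd_mat_def hermitian_mat_def)
qed

text \<open>The inner product is the sum, over the rows of \<open>X\<close>, of the quadratic form
  of \<open>L\<close> at the conjugated row.\<close>

lemma psd_mat_inner_nonneg:
  assumes "psd_mat L" "L \<in> carrier_mat k k" "X \<in> carrier_mat n k"
  shows "0 \<le> Re (mat_inner (X * L) X)"
proof -
  have "0 \<le> Re (\<Sum>a<k. \<Sum>j<k. L $$ (a, j) * cnj (X $$ (i, j)) * cnj (cnj (X $$ (i, a))))" for i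
    using conjunct2[OF iffD1[OF psd_mat_iff[OF assms(2)] assms(1)], rule_format, of "\<lambda>j. cnj (X $$ (i, j))"] .
  then have "0 \<le> Re (\<Sum>i<n. \<Sum>a<k. \<Sum>j<k. L $$ (a, j) * cnj (X $$ (i, j)) * cnj (cnj (X $$ (i, a))))"
    unfolding Re_sum[of _ "{..<n}"] by (intro sum_nonneg)
  also have "(\<Sum>i<n. \<Sum>a<k. \<Sum>j<k. L $$ (a, j) * cnj (X $$ (i, j)) * cnj (cnj (X $$ (i, a))))
      = (\<Sum>i<n. \<Sum>j<k. \<Sum>a<k. L $$ (a, j) * cnj (X $$ (i, j)) * cnj (cnj (X $$ (i, a))))"
    by (intro sum.cong refl sum.swap)
  also have "\<dots> = mat_inner (X * L) X"
    using assms by (simp add: mat_inner_def sum_distrib_left sum_distrib_right mult_ac)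
  finally show ?thesis .
qed

lemma psd_matI:
  assumes L: "L \<in> carrier_mat k k" "mat_adjoint L = L"
    and nonneg: "\<And>X. X \<in> carrier_mat 1 k \<Longrightarrow> 0 \<le> Re (mat_inner (X * L) X)"
  shows "psd_mat L"
  unfolding psd_mat_iff[OF L(1)]
proof (intro conjI allI L(2))
  fix x :: "nat \<Rightarrow> complex"
  define X where "X = mat 1 k (\<lambda>(i, j). cnj (x j))"
  have X: "X \<in> carrier_mat 1 k" by (simp add: X_def)
  have "mat_inner (X * L) X = (\<Sum>j<k. \<Sum>a<k. L $$ (a, j) * x j * cnj (x a))"
    using L(1) X
    by (simp add: mat_inner_def sum_distrib_left sum_distrib_right mult_ac, simp add: X_def mult_ac)
  also have "\<dots> = (\<Sum>a<k. \<Sum>j<k. L $$ (a, j) * x j * cnj (x a))"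
    by (rule sum.swap)
  finally show "0 \<le> Re (\<Sum>i<k. \<Sum>j<k. L $$ (i, j) * x j * cnj (x i))"
    using nonneg[OF X] by simp
qed

text \<open>Plays the role of \<open>L^2 \<le> \<parallel>L\<parallel> L\<close> without
  diagonalising \<open>L\<close>. With \<open>W = X L\<close> and
  \<open>N = \<parallel>L\<parallel>\<close>, the form is nonnegative at \<open>X - W / N\<close>;
  expanding it there gives the form at \<open>X\<close>, minus twice
  \<open>\<parallel>W\<parallel>^2 / N\<close>, plus a term that is at most
  \<open>\<parallel>W\<parallel>^2 / N\<close>.\<close>

lemma frob_norm_psd_mult_sq_le:
  assumes L: "psd_mat L" "L \<in> carrier_mat k k" and X: "X \<in> carrier_mat n k"
  shows "(frob_norm (X * L))\<^sup>2 \<le> frob_norm L * Re (mat_inner (X * L) X)"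
proof (cases "frob_norm L = 0")
  case True
  then have "frob_norm (X * L) = 0"
    using frob_norm_mult_le[OF X L(2)] frob_norm_nonneg[of "X * L"] by simp
  then show ?thesis using True by simp
next
  case False
  define N where "N = frob_norm L"
  have N: "N > 0" using False frob_norm_nonneg[of L] unfolding N_def by linarith
  define W where "W = X * L"
  define Y where "Y = complex_of_real (1 / N) \<cdot>\<^sub>m W"
  have W: "W \<in> carrier_mat n k" "W * L \<in> carrier_mat n k" and Y: "Y \<in> carrier_mat n k" "Y * L \<in> carrier_mat n k"
    using X L unfolding W_def Y_def by auto
  have YL: "Y * L = complex_of_real (1 / N) \<cdot>\<^sub>m (W * L)"
    using mult_smult_assoc_mat[OF W(1) L(2)] by (simp add: Y_def)
  have c: "Re (mat_inner (W * L) W) \<le> N * (frob_norm W)\<^sup>2"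
  proof -
    have "Re (mat_inner (W * L) W) \<le> frob_norm (W * L) * frob_norm W"
      using complex_Re_le_cmod mat_inner_bound[OF W(2,1)] by (rule order_trans)
    also have "\<dots> \<le> (frob_norm W * N) * frob_norm W"
      unfolding N_def by (intro mult_right_mono frob_norm_mult_le[OF W(1) L(2)]) simp
    finally show ?thesis by (simp add: power2_eq_square mult_ac)
  qed
  have 1: "mat_inner (W * L) X = mat_inner W W"
    using mat_inner_mult_right[OF W(1) L(2) X] psd_matD(2)[OF L(1)] by (simp add: W_def)
  have "0 \<le> Re (mat_inner ((X - Y) * L) (X - Y))"
    using psd_mat_inner_nonneg[OF L, of "X - Y" n] Y by (simp add: minus_carrier_mat)
  also have "(X - Y) * L = W - Y * L"
    using minus_mult_distrib_mat[OF X Y(1) L(2)] by (simp add: W_def)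
  also have "mat_inner (W - Y * L) (X - Y)
      = mat_inner W X - mat_inner W Y - (mat_inner (Y * L) X - mat_inner (Y * L) Y)"
    using mat_inner_diff_left[OF W(1) Y(2)] mat_inner_diff_right[OF X Y(1) W(1)]
      mat_inner_diff_right[OF X Y(1) Y(2)] by simp
  also have "mat_inner W Y = of_real (1 / N) * mat_inner W W"
    unfolding Y_def using mat_inner_smult_right[OF W(1) W(1)] by simp
  also have "mat_inner (Y * L) X = of_real (1 / N) * mat_inner W W"
    unfolding YL mat_inner_smult_left 1 ..
  also have "mat_inner (Y * L) Y = of_real (1 / N) * (of_real (1 / N) * mat_inner (W * L) W)"
    unfolding YL mat_inner_smult_left using mat_inner_smult_right[OF W(2) W(1)] by (simp add: Y_def)
  finally have "0 \<le> Re (mat_inner W X) - 2 * (frob_norm W)\<^sup>2 / N + Re (mat_inner (W * L) W) / (N * N)"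
    by (simp add: mat_inner_self Re_divide_of_real del: of_real_power)
  also have "Re (mat_inner (W * L) W) / (N * N) \<le> (N * (frob_norm W)\<^sup>2) / (N * N)"
    using c N by (intro divide_right_mono) auto
  finally have "0 \<le> Re (mat_inner W X) - (frob_norm W)\<^sup>2 / N"
    using N by (simp add: field_simps)
  then show ?thesis
    using N by (simp add: field_simps flip: W_def N_def)
qed

lemma det_nonzero_obtain_inverse:
  fixes A :: "'a :: field mat"
  assumes "A \<in> carrier_mat k k" "det A \<noteq> 0"
  obtains A' where "A' \<in> carrier_mat k k" "A * A' = 1\<^sub>m k"
  using det_non_zero_imp_unit[OF assms, of "()"] unfolding Units_def ring_mat_def by auto

text \<open>The best constant \<open>b\<close> in the lower bound is itself an eigenvalue of
  \<open>L\<close>: otherwise \<open>L - b I\<close> would be invertible and positive semidefinite,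
  hence bounded away from 0, and \<open>b\<close> could be increased. Neither a spectral
  decomposition nor a minimising vector is used.\<close>

lemma psd_mat_lower_bound:
  assumes L: "psd_mat L" "L \<in> carrier_mat k k"
    and eig: "\<And>\<mu>. 0 \<le> \<mu> \<Longrightarrow> eigenvalue L (complex_of_real \<mu>) \<Longrightarrow> c \<le> \<mu>"
    and X: "X \<in> carrier_mat n k"
  shows "c * (frob_norm X)\<^sup>2 \<le> Re (mat_inner (X * L) X)"
proof (cases "frob_norm X = 0")
  case True
  then show ?thesis using psd_mat_inner_nonneg[OF L X] by simp
next
  case False
  define S where "S = {b. \<forall>r. \<forall>Y\<in>carrier_mat r k. b * (frob_norm Y)\<^sup>2 \<le> Re (mat_inner (Y * L) Y)}"
  have "b \<le> Re (mat_inner (X * L) X) / (frob_norm X)\<^sup>2" if "b \<in> S" for b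
    using that X False by (auto simp: S_def pos_le_divide_eq)
  \<comment> \<open>The given \<open>X\<close> of nonzero norm is what bounds \<open>S\<close>; for
    \<open>k = 0\<close> every real number would belong to it.\<close>
  then have bdd: "bdd_above S" by (rule bdd_aboveI)
  have 0: "0 \<in> S"
    using psd_mat_inner_nonneg[OF L] by (simp add: S_def)
  define b where "b = Sup S"
  have b0: "0 \<le> b" unfolding b_def by (rule cSup_upper[OF 0 bdd])
  have bS: "b * (frob_norm Y)\<^sup>2 \<le> Re (mat_inner (Y * L) Y)" if Y: "Y \<in> carrier_mat r k" for Y r
  proof (cases "frob_norm Y = 0")
    case True then show ?thesis using psd_mat_inner_nonneg[OF L Y] by simp
  next
    case False
    have "b \<le> Re (mat_inner (Y * L) Y) / (frob_norm Y)\<^sup>2"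
      unfolding b_def
    proof (rule cSup_least)
      show "S \<noteq> {}" using 0 by auto
    qed (use Y False in \<open>auto simp: S_def pos_le_divide_eq\<close>)
    then show ?thesis using False by (simp add: pos_le_divide_eq)
  qed
  define A where "A = L - complex_of_real b \<cdot>\<^sub>m 1\<^sub>m k"
  have A: "A \<in> carrier_mat k k" using L by (simp add: A_def minus_carrier_mat)
  have YA: "Y * A = Y * L - complex_of_real b \<cdot>\<^sub>m Y" if "Y \<in> carrier_mat r k" for Y r
  proof -
    have "Y * A = Y * L - Y * (complex_of_real b \<cdot>\<^sub>m 1\<^sub>m k)"
      unfolding A_def by (rule mult_minus_distrib_mat[OF that L(2)]) auto
    also have "Y * (complex_of_real b \<cdot>\<^sub>m 1\<^sub>m k) = complex_of_real b \<cdot>\<^sub>m (Y * 1\<^sub>m k)"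
      by (rule mult_smult_distrib[OF that]) auto
    finally show ?thesis using right_mult_one_mat[OF that] by simp
  qed
  have inner_A: "Re (mat_inner (Y * A) Y) = Re (mat_inner (Y * L) Y) - b * (frob_norm Y)\<^sup>2"
    if "Y \<in> carrier_mat r k" for Y r
    using that L by (simp add: YA[OF that] mat_inner_diff_left[of _ r k] mat_inner_smult_left
      Re_mat_inner_self)
  have "mat_adjoint A = A"
    using L psd_matD(2)[OF L(1)] mat_adjoint_diff[of L k k "complex_of_real b \<cdot>\<^sub>m 1\<^sub>m k"]
    by (simp add: A_def mat_adjoint_smult)
  then have psd_A: "psd_mat A"
    using bS by (intro psd_matI[OF A]) (auto simp: inner_A)
  \<comment> \<open>An inverse \<open>A'\<close> gives \<open>\<parallel>Y\<parallel> \<le>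
    \<parallel>Y A\<parallel> \<parallel>A'\<parallel>\<close>, and
    \<open>frob_norm_psd_mult_sq_le\<close> turns \<open>\<parallel>Y A\<parallel>^2\<close> into
    the form of \<open>A\<close>. The form is then at least
    \<open>\<parallel>Y\<parallel>^2 / K\<close>, so that \<open>b + 1 / K\<close> would still be
    admissible.\<close>
  have "det A = 0"
  proof (rule ccontr)
    assume "det A \<noteq> 0"
    then obtain A' where A': "A' \<in> carrier_mat k k" "A * A' = 1\<^sub>m k"
      using det_nonzero_obtain_inverse[OF A] by blast
    define K where "K = (frob_norm A')\<^sup>2 * frob_norm A"
    have K: "(frob_norm Y)\<^sup>2 \<le> K * Re (mat_inner (Y * A) Y)" if Y: "Y \<in> carrier_mat r k" for Y r
    proof -
      have "Y = (Y * A) * A'"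
        using assoc_mult_mat[OF Y A A'(1)] A'(2) right_mult_one_mat[OF Y] by simp
      then have "frob_norm Y \<le> frob_norm (Y * A) * frob_norm A'"
        using frob_norm_mult_le[of "Y * A" r k A' k] Y A A' by simp
      then have "(frob_norm Y)\<^sup>2 \<le> (frob_norm (Y * A) * frob_norm A')\<^sup>2"
        by (rule power_mono) simp
      also have "\<dots> \<le> (frob_norm A * Re (mat_inner (Y * A) Y)) * (frob_norm A')\<^sup>2"
        unfolding power_mult_distrib
        by (intro mult_right_mono frob_norm_psd_mult_sq_le[OF psd_A A Y]) simp
      finally show ?thesis by (simp add: K_def mult_ac)
    qed
    have "K \<noteq> 0" using K[OF X] False by auto
    moreover have "0 \<le> K" by (simp add: K_def)
    ultimately have "0 < K" by simp
    have "b + 1 / K \<in> S"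
      unfolding S_def
    proof (intro CollectI allI ballI)
      fix r and Y :: "complex mat" assume Y: "Y \<in> carrier_mat r k"
      show "(b + 1 / K) * (frob_norm Y)\<^sup>2 \<le> Re (mat_inner (Y * L) Y)"
        using K[OF Y] inner_A[OF Y] \<open>0 < K\<close> by (simp add: field_simps)
    qed
    then have "b + 1 / K \<le> b" unfolding b_def by (rule cSup_upper[OF _ bdd])
    then show False using \<open>0 < K\<close> by simp
  qed
  then obtain v where v: "v \<in> carrier_vec k" "v \<noteq> 0\<^sub>v k" "A *\<^sub>v v = 0\<^sub>v k"
    using det_0_iff_vec_prod_zero_field[OF A] by blast
  have "L *\<^sub>v v = complex_of_real b \<cdot>\<^sub>v v"
  proof (rule eq_vecI)
    fix i assume "i < dim_vec (complex_of_real b \<cdot>\<^sub>v v)"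
    then have i: "i < k" using v by simp
    have "A *\<^sub>v v = L *\<^sub>v v - (complex_of_real b \<cdot>\<^sub>m 1\<^sub>m k) *\<^sub>v v"
      unfolding A_def using L v by (intro minus_mult_distrib_mat_vec) auto
    also have "(complex_of_real b \<cdot>\<^sub>m 1\<^sub>m k) *\<^sub>v v = complex_of_real b \<cdot>\<^sub>v v"
      using v by (intro eq_vecI) (auto simp: row_smult)
    finally have "(A *\<^sub>v v) $ i = (L *\<^sub>v v - complex_of_real b \<cdot>\<^sub>v v) $ i" by (rule arg_cong)
    then show "(L *\<^sub>v v) $ i = (complex_of_real b \<cdot>\<^sub>v v) $ i" using i v(1) L(2) unfolding v(3) by simp
  qed (use v L in auto)
  then have "eigenvalue L (complex_of_real b)"
    using v L by (auto simp: eigenvalue_def eigenvector_def)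
  then have "c \<le> b" using eig b0 by blast
  then have "c * (frob_norm X)\<^sup>2 \<le> b * (frob_norm X)\<^sup>2" by (simp add: mult_right_mono)
  then show ?thesis using bS[OF X] by linarith
qed

section \<open>Singular values and canonical angles\<close>

text \<open>By Schur triangularisation the roots, with multiplicity, form the diagonal of a matrix
  similar to \<open>A\<close>, so their sum is the trace. Number and sum of the roots are all that
  the sum of \<open>sin^2\<close> over the canonical angles requires.\<close>

lemma proots_char_poly:
  fixes A :: "complex mat"
  assumes A: "A \<in> carrier_mat k k"
  shows "set_mset (proots (char_poly A)) = {e. eigenvalue A e}"
    "size (proots (char_poly A)) = k"
    "sum_mset (proots (char_poly A)) = (\<Sum>i<k. A $$ (i, i))"
proof -
  have "char_poly A \<noteq> 0"
    using degree_monic_char_poly[OF A] by auto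
  then show "set_mset (proots (char_poly A)) = {e. eigenvalue A e}"
    using eigenvalue_root_char_poly[OF A] by auto
  show "size (proots (char_poly A)) = k"
    using degree_monic_char_poly[OF A] by (simp add: size_proots_complex)
  obtain es where es: "char_poly A = (\<Prod>e\<leftarrow>es. [:- e, 1:])"
    using char_poly_factorized[OF A] by blast
  obtain U V W where "schur_decomposition A es = (U, V, W)"
    by (metis prod_cases3)
  then have sim: "similar_mat_wit A U V W" and "diag_mat U = es"
    using schur_decomposition[OF A es] by auto
  have c: "U \<in> carrier_mat k k" "V \<in> carrier_mat k k" "W \<in> carrier_mat k k"
    and eq: "W * V = 1\<^sub>m k" "A = V * U * W"
    using similar_mat_witD2[OF A sim] by auto
  have trace_comm: "(\<Sum>i<k. (X * Y) $$ (i, i)) = (\<Sum>i<k. (Y * X) $$ (i, i))"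
    if "X \<in> carrier_mat k k" "Y \<in> carrier_mat k k" for X Y :: "complex mat"
    using that sum.swap[of "\<lambda>i j. X $$ (i, j) * Y $$ (j, i)" "{..<k}" "{..<k}"]
    by (simp add: mult.commute)
  have "proots (\<Prod>e\<leftarrow>es. [:- e, 1:]) = mset es"
  proof (induction es)
    case (Cons a es)
    have "(\<Prod>e\<leftarrow>es. [:- e, 1:]) \<noteq> 0" by (auto simp: prod_list_zero_iff)
    then have "proots ([:- a, 1:] * (\<Prod>e\<leftarrow>es. [:- e, 1:])) = proots [:- a, 1:] + proots (\<Prod>e\<leftarrow>es. [:- e, 1:])"
      by (intro proots_mult) auto
    then show ?case using Cons.IH by (simp del: mult_pCons_left)
  qed simp
  then have "sum_mset (proots (char_poly A)) = sum_list es"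
    by (simp add: es sum_mset_sum_list)
  also have "\<dots> = (\<Sum>i<k. U $$ (i, i))"
    using c \<open>diag_mat U = es\<close>
    by (auto simp: diag_mat_def sum_list_sum_nth lessThan_atLeast0)
  also have "U = (U * W) * V"
    using c eq assoc_mult_mat[OF c(1,3,2)] right_mult_one_mat[OF c(1)] by simp
  also have "(\<Sum>i<k. (U * W * V) $$ (i, i)) = (\<Sum>i<k. A $$ (i, i))"
    using c eq trace_comm[of "U * W" V] assoc_mult_mat[OF c(2,1,3)] by simp
  finally show "sum_mset (proots (char_poly A)) = (\<Sum>i<k. A $$ (i, i))" .
qed

lemma trace_adjoint_mult:
  "(\<Sum>i<dim_col X. (mat_adjoint X * X) $$ (i, i)) = of_real ((frob_norm X)\<^sup>2)"
  unfolding mat_inner_self[symmetric] mat_inner_def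
  by (subst sum.swap) (simp add: mult.commute)

text \<open>The eigenvector is repackaged as a one-column matrix, so that the Frobenius norm
  estimates apply to it; pairing the eigenvalue equation with it gives the identity.\<close>

lemma eigenvalue_gramE:
  fixes X :: "complex mat"
  assumes X: "X \<in> carrier_mat n k" and e: "eigenvalue (mat_adjoint X * X) e"
  obtains v where "v \<in> carrier_mat k 1" "0 < frob_norm v"
    "e * of_real ((frob_norm v)\<^sup>2) = of_real ((frob_norm (X * v))\<^sup>2)"
proof -
  obtain w where w: "w \<in> carrier_vec k" "w \<noteq> 0\<^sub>v k" "(mat_adjoint X * X) *\<^sub>v w = e \<cdot>\<^sub>v w"
    using e X unfolding eigenvalue_def eigenvector_def by auto
  define v where "v = mat k 1 (\<lambda>(i, j). w $ i)"
  have v: "v \<in> carrier_mat k 1" by (simp add: v_def)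
  have "frob_norm v \<noteq> 0"
  proof
    assume "frob_norm v = 0"
    then have "v = 0\<^sub>m k 1" using frob_norm_eq_0_iff[OF v] by simp
    then have "w $ i = 0" if "i < k" for i
    proof -
      have "v $$ (i, 0) = w $ i" using that by (simp add: v_def)
      then show ?thesis using \<open>v = 0\<^sub>m k 1\<close> that by simp
    qed
    then show False using w by (auto intro: eq_vecI)
  qed
  then have 0: "0 < frob_norm v" using frob_norm_nonneg[of v] by linarith
  have "(mat_adjoint X * X) * v = e \<cdot>\<^sub>m v"
  proof (rule eq_matI)
    fix i j assume ij: "i < dim_row (e \<cdot>\<^sub>m v)" "j < dim_col (e \<cdot>\<^sub>m v)"
    then have "((mat_adjoint X * X) * v) $$ (i, j) = ((mat_adjoint X * X) *\<^sub>v w) $ i"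
      using X w(1) by (simp add: v_def scalar_prod_def lessThan_atLeast0)
    then show "((mat_adjoint X * X) * v) $$ (i, j) = (e \<cdot>\<^sub>m v) $$ (i, j)"
      using ij w by (simp add: v_def)
  qed (use X v in auto)
  then have "mat_adjoint X * (X * v) = e \<cdot>\<^sub>m v"
    using assoc_mult_mat[of "mat_adjoint X" k n X k v 1] X v by simp
  then have "mat_inner (mat_adjoint X * (X * v)) v = e * mat_inner v v"
    by (simp add: mat_inner_smult_left)
  moreover have "mat_inner (mat_adjoint X * (X * v)) v = mat_inner (X * v) (X * v)"
    using mat_inner_mult_left[of "X * v" n 1 "mat_adjoint X" k v] X v by simp
  ultimately show ?thesis
    using that[OF v 0] by (simp add: mat_inner_self)
qed

lemma sigma_min_le:
  assumes X: "X \<in> carrier_mat n k" "k \<le> n" and e: "eigenvalue (mat_adjoint X * X) e"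
  shows "sigma_min X \<le> sqrt (Re e)"
proof -
  have c: "mat_adjoint X * X \<in> carrier_mat k k" using X by auto
  show ?thesis
    unfolding sigma_min_def singular_values_def
    using X e finite_set_mset[of "proots (char_poly (mat_adjoint X * X))"]
    by (intro Min_le) (auto simp: proots_char_poly(1)[OF c] simp del: set_count_proots finite_set_mset)
qed

lemma sigma_min_nonneg:
  assumes X: "X \<in> carrier_mat n k" "k \<le> n" "0 < k"
  shows "0 \<le> sigma_min X"
proof -
  have c: "mat_adjoint X * X \<in> carrier_mat k k" using X by auto
  \<comment> \<open>\<open>Min\<close> says nothing about an empty set; a characteristic polynomial
    of degree \<open>k > 0\<close> does have a root.\<close>
  have "proots (char_poly (mat_adjoint X * X)) \<noteq> {#}"
    using proots_char_poly(2)[OF c] X(3) by auto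
  then have ne: "set_mset (proots (char_poly (mat_adjoint X * X))) \<noteq> {}" by simp
  have "0 \<le> Re e" if e: "eigenvalue (mat_adjoint X * X) e" for e
  proof -
    obtain v where v: "0 < frob_norm v"
      "e * of_real ((frob_norm v)\<^sup>2) = of_real ((frob_norm (X * v))\<^sup>2)"
      using eigenvalue_gramE[OF X(1) e] by blast
    have "Re (e * of_real ((frob_norm v)\<^sup>2)) = (frob_norm (X * v))\<^sup>2"
      unfolding v(2) by simp
    then have "Re e = (frob_norm (X * v))\<^sup>2 / (frob_norm v)\<^sup>2"
      using v(1) by (simp add: field_simps del: of_real_power)
    then show ?thesis by simp
  qed
  then show ?thesis
    unfolding sigma_min_def singular_values_def
    using X ne finite_set_mset[of "proots (char_poly (mat_adjoint X * X))"]
    unfolding proots_char_poly(1)[OF c]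
    by (subst Min_ge_iff) (auto simp: proots_char_poly(1)[OF c] simp del: finite_set_mset)
qed

text \<open>Since \<open>Q^H Q = I\<close>, the Gram matrix of \<open>Q L\<close> is
  \<open>L^2\<close>. An eigenvalue \<open>\<mu> \<ge> 0\<close> of \<open>L\<close> therefore gives
  the singular value \<open>\<mu>\<close> of \<open>Q L\<close>, and
  \<open>psd_mat_lower_bound\<close> applies with the smallest one.\<close>

lemma sigma_min_polar_bound:
  assumes Q: "Q \<in> stiefel k n" and L: "psd_mat L" "L \<in> carrier_mat k k" and kn: "k \<le> n"
    and X: "X \<in> carrier_mat r k"
  shows "sigma_min (Q * L) * (frob_norm X)\<^sup>2 \<le> Re (mat_inner (X * L) X)"
proof (rule psd_mat_lower_bound[OF L _ X])
  fix \<mu> :: real assume \<mu>: "0 \<le> \<mu>" "eigenvalue L (complex_of_real \<mu>)"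
  have Qc: "Q \<in> carrier_mat n k" using Q by (simp add: stiefel_iff)
  have "mat_adjoint (Q * L) * (Q * L) = L * L"
    using Qc L psd_matD(2)[OF L(1)] assoc_mult_mat[of L k k "mat_adjoint Q" n "Q * L" k]
      stiefel_adjoint_mult_mult[OF Q L(2)]
    by (simp add: mat_adjoint_mult)
  moreover obtain v where v: "v \<in> carrier_vec k" "v \<noteq> 0\<^sub>v k" "L *\<^sub>v v = complex_of_real \<mu> \<cdot>\<^sub>v v"
    using \<mu>(2) L by (auto simp: eigenvalue_def eigenvector_def)
  have "(L * L) *\<^sub>v v = complex_of_real (\<mu>\<^sup>2) \<cdot>\<^sub>v v"
    using assoc_mult_mat_vec[OF L(2) L(2) v(1)] mult_mat_vec[OF L(2) v(1)] v
    by (simp add: smult_smult_assoc power2_eq_square)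
  ultimately have "eigenvalue (mat_adjoint (Q * L) * (Q * L)) (complex_of_real (\<mu>\<^sup>2))"
    using v L by (auto simp: eigenvalue_def eigenvector_def)
  then have "sigma_min (Q * L) \<le> sqrt (\<mu>\<^sup>2)"
    using sigma_min_le[of "Q * L" n k] Qc L kn by fastforce
  then show "sigma_min (Q * L) \<le> \<mu>" using \<mu>(1) by simp
qed

text \<open>Each column of \<open>P\<close> lies in the range of \<open>U\<close>, so
  \<open>P = U Y\<close> for some \<open>Y\<close>, and \<open>U^H U = I\<close> identifies
  \<open>Y\<close> as \<open>U^H P\<close>.\<close>

lemma stiefel_col_space_eq:
  assumes U: "U \<in> stiefel d n" and P: "P \<in> stiefel k n"
    and eq: "vec_space.col_space n U = vec_space.col_space n P"
  shows "U * (mat_adjoint U * P) = P"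
proof -
  have c: "U \<in> carrier_mat n d" "P \<in> carrier_mat n k" using U P by (auto simp: stiefel_iff)
  have "\<exists>x\<in>carrier_vec d. U *\<^sub>v x = col P j" if j: "j < k" for j
  proof -
    have "P *\<^sub>v unit_vec k j = col P j"
      using c j by (intro eq_vecI) auto
    then have "col P j \<in> vec_space.col_space n P"
      using c j unfolding vec_space.col_space_eq[OF c(2)] by auto
    then show ?thesis
      using c unfolding eq[symmetric] vec_space.col_space_eq[OF c(1)] by auto
  qed
  then obtain x where x: "\<And>j. j < k \<Longrightarrow> x j \<in> carrier_vec d \<and> U *\<^sub>v x j = col P j"
    by metis
  define Y where "Y = mat d k (\<lambda>(i, j). x j $ i)"
  have Y: "Y \<in> carrier_mat d k" by (simp add: Y_def)
  have "P = U * Y"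
  proof (rule eq_matI)
    fix i j assume "i < dim_row (U * Y)" "j < dim_col (U * Y)"
    then have ij: "i < n" "j < k" using c Y by auto
    then have "P $$ (i, j) = (U *\<^sub>v x j) $ i" using x[OF ij(2)] c ij by simp
    also have "\<dots> = (\<Sum>a<d. U $$ (i, a) * x j $ a)"
      using ij(1) c conjunct1[OF x[OF ij(2)]]
      by (simp add: scalar_prod_def lessThan_atLeast0)
    finally show "P $$ (i, j) = (U * Y) $$ (i, j)"
      using ij c Y by (simp add: Y_def)
  qed (use c Y in auto)
  then show ?thesis
    using stiefel_adjoint_mult_mult[OF U Y] by (simp only:)
qed

text \<open>Hence the Frobenius norm of \<open>U\<^sup>H V\<close> depends only on the two column spaces, whichever
  orthonormal bases the choice operator in \<^const>\<open>canonical_angles\<close> picks.\<close>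

lemma stiefel_projector_eq:
  assumes U: "U \<in> stiefel d n" and P: "P \<in> stiefel k n"
    and eq: "vec_space.col_space n U = vec_space.col_space n P"
  shows "U * mat_adjoint U = P * mat_adjoint P" "d = k"
proof -
  have c: "U \<in> carrier_mat n d" "P \<in> carrier_mat n k" "mat_adjoint U \<in> carrier_mat d n"
    "mat_adjoint P \<in> carrier_mat k n"
    using U P by (auto simp: stiefel_iff)
  define E where "E = U * mat_adjoint U"
  define F where "F = P * mat_adjoint P"
  have EF: "E \<in> carrier_mat n n" "F \<in> carrier_mat n n" using c by (auto simp: E_def F_def)
  have "E * P = P"
    using stiefel_col_space_eq[OF U P eq] assoc_mult_mat[OF c(1,3,2)] by (simp add: E_def)
  then have 1: "E * F = F"
    using assoc_mult_mat[OF EF(1) c(2,4)] by (simp add: F_def)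
  have "F * U = U"
    using stiefel_col_space_eq[OF P U eq[symmetric]] assoc_mult_mat[OF c(2,4,1)] by (simp add: F_def)
  then have 2: "F * E = E"
    using assoc_mult_mat[OF EF(2) c(1,3)] by (simp add: E_def)
  \<comment> \<open>Each projector fixes the range of the other: \<open>E F = F\<close> and
    \<open>F E = E\<close>. As both are Hermitian, \<open>F = (E F)^H = F E = E\<close>.\<close>
  have "mat_adjoint E = E" "mat_adjoint F = F"
    using c by (auto simp: E_def F_def mat_adjoint_mult)
  then have "mat_adjoint (E * F) = F * E"
    using EF by (simp add: mat_adjoint_mult)
  then show *: "U * mat_adjoint U = P * mat_adjoint P"
    using 1 2 \<open>mat_adjoint F = F\<close> by (simp flip: E_def F_def)
  \<comment> \<open>The trace of the projector counts the columns, so equal projectors have equally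
    many.\<close>
  have trace: "of_nat k = (\<Sum>i<n. (P * mat_adjoint P) $$ (i, i))" if "P \<in> stiefel k n" for k P
  proof -
    have "(\<Sum>i<n. (P * mat_adjoint P) $$ (i, i)) = of_real ((frob_norm (mat_adjoint P))\<^sup>2)"
      using that trace_adjoint_mult[of "mat_adjoint P"] by (auto simp: stiefel_iff)
    then show ?thesis
      using frob_norm_stiefel[OF that] by (simp add: frob_norm_adjoint)
  qed
  have "(of_nat d :: complex) = of_nat k" using trace[OF U] trace[OF P] * by simp
  then show "d = k" by simp
qed

lemma frob_norm_adjoint_mult_le:
  assumes "P \<in> stiefel k n" "X \<in> carrier_mat n p"
  shows "frob_norm (mat_adjoint P * X) \<le> frob_norm X"
proof (rule power2_le_imp_le)
  show "(frob_norm (mat_adjoint P * X))\<^sup>2 \<le> (frob_norm X)\<^sup>2"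
    using frob_norm_projection[OF assms] zero_le_power2 by (metis diff_ge_0_iff_ge)
qed simp

text \<open>A root \<open>e\<close> of the characteristic polynomial of \<open>W^H W\<close>
  contributes \<open>1 - Re e\<close>, provided that \<open>Re e\<close> lies in
  \<open>[0, 1]\<close>, where \<open>cos\<close> undoes \<open>arccos\<close>. This holds because
  \<open>W = U^H V\<close> is a contraction. The roots sum to the trace, which is
  \<open>\<parallel>W\<parallel>^2\<close>.\<close>

lemma sum_sin_sq_arccos_singular_values:
  assumes U: "U \<in> stiefel k n" and V: "V \<in> stiefel k n"
  shows "(\<Sum>\<theta>\<in>#image_mset arccos (singular_values (mat_adjoint U * V)). (sin \<theta>)\<^sup>2)
    = real k - (frob_norm (mat_adjoint U * V))\<^sup>2"
proof -
  define W where "W = mat_adjoint U * V"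
  define A where "A = mat_adjoint W * W"
  have Uc: "U \<in> carrier_mat n k" and Vc: "V \<in> carrier_mat n k" using U V by (auto simp: stiefel_iff)
  have W: "W \<in> carrier_mat k k" using Uc Vc by (auto simp: W_def)
  have A: "A \<in> carrier_mat k k" using W by (auto simp: A_def)
  have sv: "(sin (arccos (sqrt (Re e))))\<^sup>2 = 1 - Re e" if "e \<in># proots (char_poly A)" for e
  proof -
    have "eigenvalue (mat_adjoint W * W) e"
      using that proots_char_poly(1)[OF A] by (simp add: A_def)
    then obtain v where v: "v \<in> carrier_mat k 1" "0 < frob_norm v"
      "e * of_real ((frob_norm v)\<^sup>2) = of_real ((frob_norm (W * v))\<^sup>2)"
      using eigenvalue_gramE[OF W] by blast
    have "Re (e * of_real ((frob_norm v)\<^sup>2)) = (frob_norm (W * v))\<^sup>2"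
      unfolding v(3) by simp
    then have e: "Re e = (frob_norm (W * v))\<^sup>2 / (frob_norm v)\<^sup>2"
      using v(2) by (simp add: field_simps del: of_real_power)
    have "frob_norm (W * v) \<le> frob_norm (V * v)"
      using frob_norm_adjoint_mult_le[OF U, of "V * v" 1] assoc_mult_mat[of "mat_adjoint U" k n V k v 1]
        Uc Vc v(1) by (simp add: W_def)
    also have "\<dots> = frob_norm v" by (rule frob_norm_stiefel_mult[OF V v(1)])
    finally have "(frob_norm (W * v))\<^sup>2 \<le> (frob_norm v)\<^sup>2" by (rule power_mono) simp
    then have "0 \<le> Re e" "Re e \<le> 1" using v(2) unfolding e by simp_all
    then show ?thesis
      by (simp add: sin_squared_eq cos_arccos order_trans[of _ 0])
  qed
  have sum_diff: "(\<Sum>e\<in>#M. 1 - Re e) = real (size M) - Re (sum_mset M)" for M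
    by (induction M) simp_all
  have "singular_values W = image_mset (\<lambda>e. sqrt (Re e)) (proots (char_poly A))"
    using W by (simp add: singular_values_def A_def)
  then have "(\<Sum>\<theta>\<in>#image_mset arccos (singular_values W). (sin \<theta>)\<^sup>2)
      = (\<Sum>e\<in>#proots (char_poly A). (sin (arccos (sqrt (Re e))))\<^sup>2)"
    by (simp add: multiset.map_comp o_def)
  also have "\<dots> = (\<Sum>e\<in>#proots (char_poly A). 1 - Re e)"
    using sv by (intro arg_cong[of _ _ sum_mset] image_mset_cong)
  also have "\<dots> = real (size (proots (char_poly A))) - Re (sum_mset (proots (char_poly A)))"
    using sum_diff[of "proots (char_poly A)"] .
  also have "\<dots> = real k - (frob_norm W)\<^sup>2"
    using proots_char_poly(2,3)[OF A] trace_adjoint_mult[of W] W by (simp add: A_def)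
  finally show ?thesis by (simp add: W_def)
qed

text \<open>Turns the angles into the residual of \<open>Q\<close> after projection onto the range
  of \<open>P\<close>: both squares equal \<open>k - \<parallel>P^H Q\<parallel>^2\<close>, one by
  the trace, the other by Pythagoras.\<close>

lemma frob_norm_sin_Theta_sq:
  assumes Q: "Q \<in> stiefel k n" and P: "P \<in> stiefel k n"
  shows "(frob_norm (sin_Theta n (vec_space.col_space n Q) (vec_space.col_space n P)))\<^sup>2
    = (frob_norm (Q - P * (mat_adjoint P * Q)))\<^sup>2"
proof -
  define S where "S = vec_space.col_space n Q"
  define T where "T = vec_space.col_space n P"
  define U where "U = (SOME U. orthonormal_basis_mat n S U)"
  define V where "V = (SOME V. orthonormal_basis_mat n T V)"
  have c: "Q \<in> carrier_mat n k" "P \<in> carrier_mat n k" using Q P by (auto simp: stiefel_iff)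
  have "orthonormal_basis_mat n S Q" "orthonormal_basis_mat n T P"
    using Q P c by (auto simp: orthonormal_basis_mat_def S_def T_def)
  then have "orthonormal_basis_mat n S U" "orthonormal_basis_mat n T V"
    unfolding U_def V_def by (auto intro: someI)
  then have UV: "U \<in> stiefel k n" "V \<in> stiefel k n"
    "U * mat_adjoint U = Q * mat_adjoint Q" "V * mat_adjoint V = P * mat_adjoint P"
    using stiefel_projector_eq[of U _ n Q k] stiefel_projector_eq[of V _ n P k] Q P
    by (auto simp: orthonormal_basis_mat_def S_def T_def)
  \<comment> \<open>Written this way, the norm involves the bases only through their projectors, so
    the bases chosen by \<open>SOME\<close> may be replaced by \<open>Q\<close> and
    \<open>P\<close>.\<close>
  have inner: "complex_of_real ((frob_norm (mat_adjoint X * Y))\<^sup>2)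
      = mat_inner (Y * mat_adjoint Y) (X * mat_adjoint X)"
    if "X \<in> stiefel k n" "Y \<in> stiefel k n" for X Y
  proof -
    have d: "X \<in> carrier_mat n k" "Y \<in> carrier_mat n k" using that by (auto simp: stiefel_iff)
    have "mat_inner (mat_adjoint X * Y) (mat_adjoint X * Y)
        = mat_inner Y (X * (mat_adjoint X * Y))"
      using d mat_inner_mult_left[of Y n k "mat_adjoint X" k "mat_adjoint X * Y"] by fastforce
    also have "\<dots> = mat_inner (Y * mat_adjoint Y) (X * mat_adjoint X)"
      using d mat_inner_mult_right[of Y n k "mat_adjoint Y" n "X * mat_adjoint X"]
        assoc_mult_mat[of X n k "mat_adjoint X" n Y k] by simp
    finally show ?thesis by (simp add: mat_inner_self)
  qed
  have "complex_of_real ((frob_norm (mat_adjoint U * V))\<^sup>2) = of_real ((frob_norm (mat_adjoint Q * P))\<^sup>2)"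
    unfolding inner[OF UV(1,2)] inner[OF Q P] UV(3,4) ..
  then have eq: "(frob_norm (mat_adjoint U * V))\<^sup>2 = (frob_norm (mat_adjoint Q * P))\<^sup>2"
    using of_real_eq_iff by blast
  have PQ: "frob_norm (mat_adjoint Q * P) = frob_norm (mat_adjoint P * Q)"
    using frob_norm_adjoint[of "mat_adjoint P * Q"] c by (simp add: mat_adjoint_mult)
  define M where "M = canonical_angles n S T"
  define ths where "ths = sorted_list_of_multiset M"
  have "(frob_norm (sin_Theta n S T))\<^sup>2
      = (\<Sum>i<length ths. \<Sum>j<length ths. if i = j then (sin (ths ! i))\<^sup>2 else 0)"
    unfolding sin_Theta_def M_def[symmetric] ths_def[symmetric] Let_def frob_norm_sq
    by (simp add: mat_diag_def if_distrib[of cmod] if_distrib[of "\<lambda>x. x\<^sup>2"] cong: if_cong)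
  also have "\<dots> = (\<Sum>\<theta>\<leftarrow>ths. (sin \<theta>)\<^sup>2)"
    by (simp add: sum_list_sum_nth lessThan_atLeast0)
  also have "\<dots> = (\<Sum>\<theta>\<in>#M. (sin \<theta>)\<^sup>2)"
    by (metis mset_map mset_sorted_list_of_multiset sum_mset_sum_list ths_def)
  also have "\<dots> = real k - (frob_norm (mat_adjoint P * Q))\<^sup>2"
    unfolding M_def canonical_angles_def U_def[symmetric] V_def[symmetric] Let_def
    using sum_sin_sq_arccos_singular_values[OF UV(1,2)] eq PQ by simp
  also have "\<dots> = (frob_norm (Q - P * (mat_adjoint P * Q)))\<^sup>2"
    using frob_norm_projection[OF P c(1)] frob_norm_stiefel[OF Q] by simp
  finally show ?thesis by (simp add: S_def T_def)
qed

section \<open>Tensors\<close>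

lemma multi_indices_iff:
  "is \<in> set (multi_indices ds) \<longleftrightarrow> length is = length ds \<and> (\<forall>i<length ds. is ! i < ds ! i)"
  by (auto simp: multi_indices_def product_lists_set list_all2_conv_all_nth)

lemma distinct_multi_indices: "distinct (multi_indices ds)"
  unfolding multi_indices_def by (rule distinct_product_lists) auto

lemma multi_indices_update:
  assumes "is \<in> set (multi_indices (ds[l := d]))" "j < d'" "l < length ds"
  shows "is[l := j] \<in> set (multi_indices (ds[l := d']))"
  using assms by (auto simp: multi_indices_iff nth_list_update)

text \<open>A multi-index amounts to its entry at \<open>l\<close> together with the representative
  having 0 there, which is how \<open>unfolding_mat\<close> numbers its columns. The dimension
  \<open>d\<close> is free because a product in mode \<open>l\<close> changes just this one.\<close>

lemma sum_multi_indices_unfold: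
  fixes g :: "nat list \<Rightarrow> 'a :: comm_monoid_add"
  assumes l: "l < length ds"
  shows "(\<Sum>is\<in>set (multi_indices (ds[l := d])). g is)
    = (\<Sum>i<d. \<Sum>c<length (multi_indices (ds[l := 1])). g ((multi_indices (ds[l := 1]) ! c)[l := i]))"
proof -
  let ?cs = "multi_indices (ds[l := 1])"
  have "(\<Sum>is\<in>set (multi_indices (ds[l := d])). g is) = (\<Sum>(i, is)\<in>{..<d} \<times> set ?cs. g (is[l := i]))"
  proof (rule sum.reindex_bij_witness[of _ "\<lambda>(i, is). is[l := i]" "\<lambda>is. (is ! l, is[l := 0])"])
    fix x assume "x \<in> {..<d} \<times> set ?cs"
    then show "(case x of (i, is) \<Rightarrow> is[l := i]) \<in> set (multi_indices (ds[l := d]))"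
      using multi_indices_update[OF _ _ l] by (auto split: prod.splits)
    from \<open>x \<in> _\<close> obtain i "is" where x: "x = (i, is)" "is \<in> set ?cs" by auto
    then have "is ! l = 0" "length is = length ds" using l by (auto simp: multi_indices_iff nth_list_update)
    then show "((case x of (i, is) \<Rightarrow> is[l := i]) ! l, (case x of (i, is) \<Rightarrow> is[l := i])[l := 0]) = x"
      using l x by (metis case_prod_conv list_update_id list_update_overwrite nth_list_update_eq)
  next
    fix "is" assume "is": "is \<in> set (multi_indices (ds[l := d]))"
    then show "(is ! l, is[l := 0]) \<in> {..<d} \<times> set ?cs"
      using l multi_indices_update[OF "is" _ l, of 0 1] by (auto simp: multi_indices_iff)
  qed auto
  also have "\<dots> = (\<Sum>i<d. \<Sum>is\<in>set ?cs. g (is[l := i]))"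
    by (simp add: sum.cartesian_product)
  also have "\<dots> = (\<Sum>i<d. \<Sum>c<length ?cs. g ((?cs ! c)[l := i]))"
    by (intro sum.cong refl sum.reindex_bij_betw[symmetric] bij_betw_nth distinct_multi_indices)
  finally show ?thesis .
qed

lemma tdims_mode_mult [simp]: "tdims (mode_mult l X T) = (tdims T)[l := dim_row X]"
  by (simp add: mode_mult_def)

text \<open>On the unfolding, the product in mode \<open>l\<close> is left multiplication by
  \<open>X\<close>; both norms sum the same entries.\<close>

lemma tensor_norm_mode_mult:
  assumes l: "l < length (tdims T)" and X: "X \<in> carrier_mat r (tdims T ! l)"
  shows "tensor_norm (mode_mult l X T) = frob_norm (X * unfolding_mat l T)"
proof -
  let ?cs = "multi_indices ((tdims T)[l := 1])"
  have "(tensor_norm (mode_mult l X T))\<^sup>2 = (\<Sum>i<r. \<Sum>c<length ?cs.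
      (cmod (\<Sum>j<tdims T ! l. X $$ ((?cs ! c)[l := i] ! l, j) * tentry T ((?cs ! c)[l := i, l := j])))\<^sup>2)"
    using X unfolding tensor_norm_def mode_mult_def
    by (simp add: sum_multi_indices_unfold[OF l] sum_nonneg)
  also have "\<dots> = (\<Sum>i<r. \<Sum>c<length ?cs. (cmod ((X * unfolding_mat l T) $$ (i, c)))\<^sup>2)"
  proof (intro sum.cong refl)
    fix i c assume ic: "i \<in> {..<r}" "c \<in> {..<length ?cs}"
    then have "?cs ! c \<in> set ?cs" by simp
    then have "length (?cs ! c) = length (tdims T)" by (simp add: multi_indices_iff)
    then show "(cmod (\<Sum>j<tdims T ! l. X $$ ((?cs ! c)[l := i] ! l, j) * tentry T ((?cs ! c)[l := i, l := j])))\<^sup>2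
        = (cmod ((X * unfolding_mat l T) $$ (i, c)))\<^sup>2"
      using ic X l by (simp add: unfolding_mat_def Let_def)
  qed
  also have "\<dots> = (frob_norm (X * unfolding_mat l T))\<^sup>2"
    using X by (simp add: frob_norm_sq unfolding_mat_def Let_def)
  finally show ?thesis
    by (simp add: tensor_norm_def sum_nonneg)
qed

lemma mode_mult_commute:
  assumes "l \<noteq> l'"
  shows "mode_mult l X (mode_mult l' Y T) = mode_mult l' Y (mode_mult l X T)"
proof -
  have "(\<Sum>j<tdims T ! l. X $$ (is ! l, j) * (\<Sum>j'<tdims T ! l'. Y $$ (is ! l', j') * tentry T (is[l := j, l' := j'])))
      = (\<Sum>j'<tdims T ! l'. Y $$ (is ! l', j') * (\<Sum>j<tdims T ! l. X $$ (is ! l, j) * tentry T (is[l' := j', l := j])))"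
    for "is"
    unfolding sum_distrib_left
    by (subst sum.swap) (intro sum.cong refl, simp add: list_update_swap[OF assms] mult_ac)
  then show ?thesis
    using assms by (simp add: mode_mult_def list_update_swap[of l' l])
qed

text \<open>Products in different modes commute, so any mode can be applied last. Then
  \<open>P l\<close> enters the objective through the outermost product alone.\<close>

lemma mode_mults_snoc_remove:
  assumes l: "l < length (tdims B)"
  shows "mode_mults k s P [0..<length (tdims B)] B
    = mode_mult l (mat_adjoint (col_block (k l) s (P l)))
        (mode_mults k s P (filter (\<lambda>i. i \<noteq> l) [0..<length (tdims B)]) B)"
proof -
  let ?f = "\<lambda>l. mode_mult l (mat_adjoint (col_block (k l) s (P l)))"
  let ?xs = "[0..<length (tdims B)]"
  have comm: "?f x \<circ> ?f y = ?f y \<circ> ?f x" for x y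
    by (cases "x = y") (auto simp: mode_mult_commute)
  have "fold ?f ?xs = fold ?f (remove1 l ?xs) \<circ> ?f l"
    by (rule fold_remove1_split) (use l comm in auto)
  also have "\<dots> = ?f l \<circ> fold ?f (remove1 l ?xs)"
    by (rule fold_commute[symmetric], rule comm)
  also have "remove1 l ?xs = filter (\<lambda>i. i \<noteq> l) ?xs"
    unfolding distinct_remove1_removeAll[OF distinct_upt] removeAll_filter_not_eq
    by (rule filter_cong) auto
  finally show ?thesis by (simp add: mode_mults_def)
qed

lemma mode_mults_cong:
  assumes "\<And>i. i \<in> set ls \<Longrightarrow> P i = Q i"
  shows "mode_mults k s P ls T = mode_mults k s Q ls T"
  using assms unfolding mode_mults_def by (induction ls arbitrary: T) auto

lemma dim_col_block [simp]:
  "dim_row (col_block w s P) = dim_row P" "dim_col (col_block w s P) = w s"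
  by (simp_all add: col_block_def)

lemma col_block_carrier [simp]: "P \<in> carrier_mat n c \<Longrightarrow> col_block w s P \<in> carrier_mat n (w s)"
  by auto

lemma tdims_mode_mults:
  "length (tdims (mode_mults k s P ls T)) = length (tdims T)"
  "i < length (tdims T) \<Longrightarrow>
    tdims (mode_mults k s P ls T) ! i = (if i \<in> set ls then k i s else tdims T ! i)"
  unfolding mode_mults_def
  by (induction ls arbitrary: T) (auto simp: nth_list_update)

text \<open>\<open>C_mat\<close> skips mode \<open>l\<close>, hence stays fixed while
  \<open>P l\<close> alone is moved. This is why the objective is quadratic in each single
  factor.\<close>

lemma C_mat_cong:
  assumes "\<And>i. i < length (tdims B) \<Longrightarrow> i \<noteq> l \<Longrightarrow> P i = Q i"
  shows "C_mat k B P l s = C_mat k B Q l s"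
  unfolding C_mat_def
  using mode_mults_cong[of "filter (\<lambda>i. i \<noteq> l) [0..<length (tdims B)]" P Q k _ B] assms by simp

lemma dim_row_C_mat [simp]: "l < length (tdims B) \<Longrightarrow> dim_row (C_mat k B P l s) = tdims B ! l"
  by (simp add: C_mat_def unfolding_mat_def Let_def tdims_mode_mults)

lemma H_mat_carrier [simp]:
  "l < length (tdims B) \<Longrightarrow> H_mat k B P l s \<in> carrier_mat (tdims B ! l) (tdims B ! l)"
  by (rule carrier_matI) (simp_all add: H_mat_def)

lemma objective_cong:
  assumes "\<And>i. i < length (tdims B) \<Longrightarrow> P i = Q i"
  shows "objective t k B P = objective t k B Q"
  unfolding objective_def
  using mode_mults_cong[of "[0..<length (tdims B)]" P Q k _ B] assms by simp

lemma frob_norm_adjoint_mult_sq: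
  assumes X: "X \<in> carrier_mat n k" and C: "C \<in> carrier_mat n q"
  shows "(frob_norm (mat_adjoint X * C))\<^sup>2 = Re (mat_inner ((C * mat_adjoint C) * X) X)"
proof -
  have c: "mat_adjoint C * X \<in> carrier_mat q k" using X C by auto
  have "frob_norm (mat_adjoint X * C) = frob_norm (mat_adjoint C * X)"
    using frob_norm_adjoint[of "mat_adjoint C * X"] X C by (simp add: mat_adjoint_mult)
  moreover have "mat_inner (C * (mat_adjoint C * X)) X = mat_inner (mat_adjoint C * X) (mat_adjoint C * X)"
    by (rule mat_inner_mult_left[OF c C X])
  moreover have "C * (mat_adjoint C * X) = (C * mat_adjoint C) * X"
    using assoc_mult_mat[OF C _ X] C by simp
  ultimately show ?thesis by (simp flip: Re_mat_inner_self)
qed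

text \<open>With mode \<open>l\<close> applied last, block \<open>s\<close> contributes
  \<open>\<parallel>X^H C\<parallel>^2\<close>, which is the quadratic form of \<open>C C^H\<close>
  at the block \<open>X\<close>.\<close>

lemma objective_eq_quadratic:
  assumes l: "l < length (tdims B)" and P: "P l \<in> carrier_mat (tdims B ! l) c"
  shows "objective t k B P
    = (\<Sum>s<t. Re (mat_inner (H_mat k B P l s * col_block (k l) s (P l)) (col_block (k l) s (P l))))"
  unfolding objective_def
proof (intro sum.cong refl)
  fix s
  let ?X = "col_block (k l) s (P l)" and ?C = "C_mat k B P l s"
  let ?T = "mode_mults k s P (filter (\<lambda>i. i \<noteq> l) [0..<length (tdims B)]) B"
  have X: "?X \<in> carrier_mat (tdims B ! l) (k l s)" using P by simp
  have C: "?C \<in> carrier_mat (tdims B ! l) (dim_col ?C)" using l by (intro carrier_matI) simp_all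
  have T: "l < length (tdims ?T)" "tdims ?T ! l = tdims B ! l"
    using l by (simp_all add: tdims_mode_mults)
  have "tensor_norm (mode_mults k s P [0..<length (tdims B)] B) = frob_norm (mat_adjoint ?X * ?C)"
  proof -
    have 1: "mat_adjoint ?X \<in> carrier_mat (k l s) (tdims ?T ! l)"
      unfolding T(2) by (rule mat_adjoint_carrier[OF X])
    have "tensor_norm (mode_mult l (mat_adjoint ?X) ?T) = frob_norm (mat_adjoint ?X * unfolding_mat l ?T)"
      by (rule tensor_norm_mode_mult[OF T(1) 1])
    then show ?thesis
      by (simp only: mode_mults_snoc_remove[OF l, of k s P] C_mat_def)
  qed
  then show "(tensor_norm (mode_mults k s P [0..<length (tdims B)] B))\<^sup>2
      = Re (mat_inner (H_mat k B P l s * ?X) ?X)"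
    by (simp only: H_mat_def frob_norm_adjoint_mult_sq[OF X C])
qed

section \<open>Column blocks and the partial gradients\<close>

lemma sum_lessThan_add:
  fixes g :: "nat \<Rightarrow> 'a :: comm_monoid_add"
  shows "(\<Sum>j<a + b. g j) = (\<Sum>j<a. g j) + (\<Sum>c<b. g (a + c))"
  by (induction b) (simp_all add: add.assoc)

lemma sum_blocks:
  fixes g :: "nat \<Rightarrow> 'a :: comm_monoid_add" and t :: nat
  shows "(\<Sum>j<(\<Sum>s<t. w s). g j) = (\<Sum>s<t. \<Sum>c<w s. g ((\<Sum>r<s. w r) + c))"
  by (induction t) (simp_all add: sum_lessThan_add)

lemma block_index_less:
  fixes w :: "nat \<Rightarrow> nat"
  assumes "s < t" "c < w s"
  shows "(\<Sum>r<s. w r) + c < (\<Sum>r<t. w r)"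
proof -
  have "(\<Sum>r<s. w r) + c < (\<Sum>r<Suc s. w r)" using assms by simp
  also have "\<dots> \<le> (\<Sum>r<t. w r)" using assms by (intro sum_mono2) auto
  finally show ?thesis .
qed

lemma block_index_exists:
  fixes w :: "nat \<Rightarrow> nat"
  shows "j < (\<Sum>s<t. w s) \<Longrightarrow> \<exists>s c. s < t \<and> c < w s \<and> j = (\<Sum>r<s. w r) + c"
proof (induction t)
  case (Suc t)
  show ?case
  proof (cases "j < (\<Sum>s<t. w s)")
    case True
    then show ?thesis using Suc.IH less_Suc_eq by metis
  next
    case False
    then show ?thesis
      using Suc.prems by (intro exI[of _ t] exI[of _ "j - (\<Sum>s<t. w s)"]) auto
  qed
qed simp

lemma mat_inner_col_blocks:
  assumes "X \<in> carrier_mat n (\<Sum>s<t. w s)" "Y \<in> carrier_mat n (\<Sum>s<t. w s)"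
  shows "mat_inner X Y = (\<Sum>s<t. mat_inner (col_block w s X) (col_block w s Y))"
proof -
  have "mat_inner X Y = (\<Sum>i<n. \<Sum>s<t. \<Sum>c<w s.
      X $$ (i, (\<Sum>r<s. w r) + c) * cnj (Y $$ (i, (\<Sum>r<s. w r) + c)))"
    using assms by (simp add: mat_inner_def sum_blocks)
  also have "\<dots> = (\<Sum>s<t. \<Sum>i<n. \<Sum>c<w s.
      X $$ (i, (\<Sum>r<s. w r) + c) * cnj (Y $$ (i, (\<Sum>r<s. w r) + c)))"
    by (rule sum.swap)
  also have "\<dots> = (\<Sum>s<t. mat_inner (col_block w s X) (col_block w s Y))"
    using assms by (simp add: mat_inner_def col_block_def)
  finally show ?thesis .
qed

lemma col_block_diff:
  assumes "X \<in> carrier_mat n (\<Sum>s<t. w s)" "Y \<in> carrier_mat n (\<Sum>s<t. w s)" "s < t"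
  shows "col_block w s (X - Y) = col_block w s X - col_block w s Y"
  using assms block_index_less[OF assms(3), of _ w]
  by (intro eq_matI) (auto simp: col_block_def)

lemma length_concat_cols:
  "(\<And>s. s < t \<Longrightarrow> dim_col (M s) = w s) \<Longrightarrow>
    length (concat (map (\<lambda>s. cols (M s)) [0..<t])) = (\<Sum>s<t. w s)"
  by (induction t) simp_all

lemma nth_concat_cols:
  assumes "\<And>s. s < t \<Longrightarrow> dim_col (M s) = w s" "s < t" "c < w s"
  shows "concat (map (\<lambda>s. cols (M s)) [0..<t]) ! ((\<Sum>r<s. w r) + c) = col (M s) c"
  using assms
proof (induction t)
  case (Suc t)
  have len: "length (concat (map (\<lambda>s. cols (M s)) [0..<t])) = (\<Sum>s<t. w s)"
    by (rule length_concat_cols) (use Suc.prems(1) in auto)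
  show ?case
  proof (cases "s < t")
    case True
    have "concat (map (\<lambda>s. cols (M s)) [0..<t]) ! ((\<Sum>r<s. w r) + c) = col (M s) c"
      by (rule Suc.IH) (use Suc.prems True in auto)
    then show ?thesis
      using block_index_less[OF True, of c w] Suc.prems(3) len by (simp add: nth_append)
  next
    case False
    then have "s = t" using Suc.prems(2) by simp
    then show ?thesis using len Suc.prems by (simp add: nth_append)
  qed
qed simp

lemma hconcat_blocks:
  assumes "\<And>s. s < t \<Longrightarrow> M s \<in> carrier_mat n (w s)"
  shows "hconcat n (map M [0..<t]) \<in> carrier_mat n (\<Sum>s<t. w s)"
    "s < t \<Longrightarrow> col_block w s (hconcat n (map M [0..<t])) = M s"
proof -
  have d: "\<And>s. s < t \<Longrightarrow> dim_col (M s) = w s" using assms by auto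
  note cs = length_concat_cols[of t M w, OF d] nth_concat_cols[of t M w, OF d]
  have *: "hconcat n (map M [0..<t]) = mat_of_cols n (concat (map (\<lambda>s. cols (M s)) [0..<t]))"
    by (simp add: hconcat_def o_def)
  show c: "hconcat n (map M [0..<t]) \<in> carrier_mat n (\<Sum>s<t. w s)"
    unfolding * using cs(1) by (intro carrier_matI) auto
  assume s: "s < t"
  show "col_block w s (hconcat n (map M [0..<t])) = M s"
  proof (rule eq_matI)
    fix i c assume "i < dim_row (M s)" "c < dim_col (M s)"
    then have ic: "i < n" "c < w s" using assms[OF s] by auto
    then show "col_block w s (hconcat n (map M [0..<t])) $$ (i, c) = M s $$ (i, c)"
      using block_index_less[of s t c w] cs assms[OF s] s
      by (simp add: col_block_def *) (simp add: mat_of_cols_def)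
  qed (use assms[OF s] c in auto)
qed

section \<open>The partial gradient and the first-order lower bound for the objective\<close>

context
  fixes t :: nat and k :: "nat \<Rightarrow> nat \<Rightarrow> nat" and B :: ctensor and l :: nat
  assumes l: "l < length (tdims B)"
begin

lemma grad_carrier:
  assumes P: "P l \<in> carrier_mat (tdims B ! l) (\<Sum>s<t. k l s)"
  shows "grad t k B l P \<in> carrier_mat (tdims B ! l) (\<Sum>s<t. k l s)"
  unfolding grad_def using P l
  by (intro smult_carrier_mat hconcat_blocks(1) mult_carrier_mat[OF H_mat_carrier] col_block_carrier)

lemma col_block_grad:
  assumes P: "P l \<in> carrier_mat (tdims B ! l) (\<Sum>s<t. k l s)" and s: "s < t"
  shows "col_block (k l) s (grad t k B l P) = 2 \<cdot>\<^sub>m (H_mat k B P l s * col_block (k l) s (P l))"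
proof -
  let ?M = "\<lambda>s. H_mat k B P l s * col_block (k l) s (P l)"
  have M: "?M s \<in> carrier_mat (tdims B ! l) (k l s)" for s
    using P l by (intro mult_carrier_mat[OF H_mat_carrier] col_block_carrier)
  let ?G = "hconcat (tdims B ! l) (map ?M [0..<t])"
  have G: "?G \<in> carrier_mat (tdims B ! l) (\<Sum>s<t. k l s)"
    by (rule hconcat_blocks(1)) (rule M)
  have "col_block (k l) s (2 \<cdot>\<^sub>m ?G) = 2 \<cdot>\<^sub>m col_block (k l) s ?G"
    using G block_index_less[OF s, of _ "k l"]
    by (intro eq_matI) (auto simp: col_block_def)
  then show ?thesis
    unfolding grad_def using hconcat_blocks(2)[of t ?M _ "k l" s, OF M s] by simp
qed

lemma grad_cong:
  assumes "\<And>i. i < length (tdims B) \<Longrightarrow> P i = Q i"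
  shows "grad t k B l P = grad t k B l Q"
proof -
  have "H_mat k B P l s = H_mat k B Q l s" for s
    using C_mat_cong[of B l P Q k s] assms by (simp add: H_mat_def)
  then show ?thesis using assms[OF l] by (simp add: grad_def)
qed

text \<open>Convexity: \<open>H = C C\<^sup>H\<close>, so the gap is the sum of the nonnegative terms
  \<open>\<parallel>C\<^sup>H (Y - X)\<parallel>\<^sup>2\<close>, where \<open>X\<close> and \<open>Y\<close> are corresponding column blocks of \<open>P l\<close> and \<open>Q l\<close>.\<close>

lemma objective_increment:
  assumes P: "P l \<in> carrier_mat (tdims B ! l) (\<Sum>s<t. k l s)"
    and Q: "Q l \<in> carrier_mat (tdims B ! l) (\<Sum>s<t. k l s)"
    and PQ: "\<And>i. i < length (tdims B) \<Longrightarrow> i \<noteq> l \<Longrightarrow> Q i = P i"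
  shows "Re (mat_inner (grad t k B l P) (Q l - P l)) \<le> objective t k B Q - objective t k B P"
proof -
  let ?X = "\<lambda>s. col_block (k l) s (P l)" and ?Y = "\<lambda>s. col_block (k l) s (Q l)"
  let ?n = "tdims B ! l" and ?H = "\<lambda>s. H_mat k B P l s"
  have H: "H_mat k B Q l s = ?H s" for s
    using C_mat_cong[of B l P Q k s] PQ by (simp add: H_mat_def)
  have convex: "2 * Re (mat_inner (?H s * ?X s) (?Y s - ?X s))
      \<le> Re (mat_inner (?H s * ?Y s) (?Y s)) - Re (mat_inner (?H s * ?X s) (?X s))" for s
  proof -
    let ?C = "C_mat k B P l s"
    let ?q = "dim_col ?C"
    have C: "?C \<in> carrier_mat ?n ?q" using l by (intro carrier_matI) simp_all
    have X: "?X s \<in> carrier_mat ?n (k l s)" and Y: "?Y s \<in> carrier_mat ?n (k l s)"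
      using P Q by simp_all
    define U where "U = mat_adjoint ?C * ?X s"
    define V where "V = mat_adjoint ?C * ?Y s"
    have U: "U \<in> carrier_mat ?q (k l s)" and V: "V \<in> carrier_mat ?q (k l s)"
      unfolding U_def V_def using mat_adjoint_carrier[OF C] X Y by (auto intro: mult_carrier_mat)
    have HX: "?H s * ?X s = ?C * U" and HY: "?H s * ?Y s = ?C * V"
      unfolding H_mat_def U_def V_def
      using assoc_mult_mat[OF C mat_adjoint_carrier[OF C]] X Y by simp_all
    have XX: "mat_inner (?C * U) (?X s) = mat_inner U U"
      unfolding mat_inner_mult_left[OF U C X] by (simp add: U_def)
    have XY: "mat_inner (?C * U) (?Y s) = mat_inner U V"
      unfolding mat_inner_mult_left[OF U C Y] by (simp add: V_def)
    have YY: "mat_inner (?C * V) (?Y s) = mat_inner V V"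
      unfolding mat_inner_mult_left[OF V C Y] by (simp add: V_def)
    have "mat_inner (V - U) (V - U) = mat_inner V V - mat_inner V U - (mat_inner U V - mat_inner U U)"
      using mat_inner_diff_left[OF V U, of "V - U"] mat_inner_diff_right[OF V U V]
        mat_inner_diff_right[OF V U U] by simp
    then have "0 \<le> Re (mat_inner V V - mat_inner V U - (mat_inner U V - mat_inner U U))"
      by (metis Re_mat_inner_self zero_le_power2)
    then have "2 * Re (mat_inner U V) \<le> Re (mat_inner V V) + Re (mat_inner U U)"
      using mat_inner_commute[OF U V] by simp
    moreover have "mat_inner (?C * U) (?Y s - ?X s) = mat_inner U V - mat_inner U U"
      using mat_inner_diff_right[OF Y X mult_carrier_mat[OF C U]] XX XY by simp
    ultimately show ?thesis
      unfolding HX HY XX YY by simp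
  qed
  have D: "Q l - P l \<in> carrier_mat ?n (\<Sum>s<t. k l s)" using P by (rule minus_carrier_mat)
  have "mat_inner (grad t k B l P) (Q l - P l)
      = (\<Sum>s<t. mat_inner (2 \<cdot>\<^sub>m (?H s * ?X s)) (?Y s - ?X s))"
    unfolding mat_inner_col_blocks[OF grad_carrier[of P, OF P] D]
    using col_block_grad[of P, OF P] col_block_diff[OF Q P] by (intro sum.cong) auto
  then have "Re (mat_inner (grad t k B l P) (Q l - P l))
      = (\<Sum>s<t. 2 * Re (mat_inner (?H s * ?X s) (?Y s - ?X s)))"
    by (simp add: mat_inner_smult_left)
  also have "\<dots> \<le> (\<Sum>s<t. Re (mat_inner (?H s * ?Y s) (?Y s)) - Re (mat_inner (?H s * ?X s) (?X s)))"
    by (intro sum_mono convex)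
  also have "\<dots> = objective t k B Q - objective t k B P"
    unfolding objective_eq_quadratic[of l B Q, OF l Q] objective_eq_quadratic[of l B P, OF l P] H
    by (simp add: sum_subtractf)
  finally show ?thesis .
qed

end

section \<open>Limits\<close>

lemma LIMSEQ_0_comparison:
  fixes f g :: "nat \<Rightarrow> real"
  assumes "g \<longlonglongrightarrow> 0" "\<And>i. f i \<le> g i" "\<And>i. 0 \<le> f i"
  shows "f \<longlonglongrightarrow> 0"
  by (rule real_tendsto_sandwich[of "\<lambda>_. 0" f _ g]) (use assms in auto)

text \<open>The shape is constant along the sequence, so convergence in norm is entrywise. Products,
  blocks and tensor contractions thereby reduce to finite sums of complex sequences.\<close>

lemma mat_LIMSEQ_iff:
  "mat_LIMSEQ X A \<longleftrightarrow> (\<forall>n. X n \<in> carrier_mat (dim_row A) (dim_col A)) \<and>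
    (\<forall>i<dim_row A. \<forall>j<dim_col A. (\<lambda>n. X n $$ (i, j)) \<longlonglongrightarrow> A $$ (i, j))"
proof (cases "\<forall>n. X n \<in> carrier_mat (dim_row A) (dim_col A)")
  case True
  then have d: "dim_row (X n - A) = dim_row A" "dim_col (X n - A) = dim_col A" for n by auto
  have "(\<lambda>n. frob_norm (X n - A)) \<longlonglongrightarrow> 0 \<longleftrightarrow>
      (\<forall>i<dim_row A. \<forall>j<dim_col A. (\<lambda>n. X n $$ (i, j)) \<longlonglongrightarrow> A $$ (i, j))"
  proof (intro iffI allI impI)
    fix i j assume lim: "(\<lambda>n. frob_norm (X n - A)) \<longlonglongrightarrow> 0" and ij: "i < dim_row A" "j < dim_col A"
    have "cmod (X n $$ (i, j) - A $$ (i, j)) \<le> frob_norm (X n - A)" for n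
      using norm_entry_le_frob_norm[of i "X n - A" j] d ij by simp
    then have "(\<lambda>n. X n $$ (i, j) - A $$ (i, j)) \<longlonglongrightarrow> 0"
      by (intro tendsto_0_le[OF lim, of _ 1]) simp
    then show "(\<lambda>n. X n $$ (i, j)) \<longlonglongrightarrow> A $$ (i, j)" by (simp add: LIM_zero_iff)
  next
    assume lim: "\<forall>i<dim_row A. \<forall>j<dim_col A. (\<lambda>n. X n $$ (i, j)) \<longlonglongrightarrow> A $$ (i, j)"
    have "(\<lambda>n. sqrt (\<Sum>i<dim_row A. \<Sum>j<dim_col A. (cmod (X n $$ (i, j) - A $$ (i, j)))\<^sup>2))
        \<longlonglongrightarrow> sqrt (\<Sum>i<dim_row A. \<Sum>j<dim_col A. (cmod (A $$ (i, j) - A $$ (i, j)))\<^sup>2)"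
      using lim by (intro tendsto_intros) auto
    then show "(\<lambda>n. frob_norm (X n - A)) \<longlonglongrightarrow> 0"
      unfolding frob_norm_def d by simp
  qed
  then show ?thesis by (simp add: mat_LIMSEQ_def True)
next
  case False
  then show ?thesis unfolding mat_LIMSEQ_def by blast
qed

lemma mat_LIMSEQ_carrier:
  "mat_LIMSEQ X A \<Longrightarrow> A \<in> carrier_mat n k \<Longrightarrow> X j \<in> carrier_mat n k"
  by (auto simp: mat_LIMSEQ_def)

lemma mat_LIMSEQ_carrier_limit:
  "mat_LIMSEQ X A \<Longrightarrow> X j \<in> carrier_mat n k \<Longrightarrow> A \<in> carrier_mat n k"
  unfolding mat_LIMSEQ_def by (metis carrier_matD carrier_matI)

lemma mat_LIMSEQ_unique:
  assumes "mat_LIMSEQ X A" "mat_LIMSEQ X A'"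
  shows "A = A'"
proof (rule eq_matI)
  have "dim_row A = dim_row A' \<and> dim_col A = dim_col A'"
    using assms unfolding mat_LIMSEQ_def by (metis carrier_matD)
  then show d: "dim_row A = dim_row A'" "dim_col A = dim_col A'" by auto
  fix i j assume "i < dim_row A'" "j < dim_col A'"
  then show "A $$ (i, j) = A' $$ (i, j)"
    using assms d LIMSEQ_unique unfolding mat_LIMSEQ_iff by metis
qed

lemma mat_LIMSEQ_subseq: "mat_LIMSEQ X A \<Longrightarrow> strict_mono r \<Longrightarrow> mat_LIMSEQ (\<lambda>n. X (r n)) A"
  unfolding mat_LIMSEQ_iff using LIMSEQ_subseq_LIMSEQ[unfolded o_def] by blast

lemma mat_LIMSEQ_const: "mat_LIMSEQ (\<lambda>n. A) A"
  by (simp add: mat_LIMSEQ_iff)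

lemma mat_LIMSEQ_mult:
  assumes "mat_LIMSEQ X A" "mat_LIMSEQ Y C" "dim_col A = dim_row C"
  shows "mat_LIMSEQ (\<lambda>n. X n * Y n) (A * C)"
proof -
  have d: "X n \<in> carrier_mat (dim_row A) (dim_row C)" "Y n \<in> carrier_mat (dim_row C) (dim_col C)" for n
    using assms by (auto simp: mat_LIMSEQ_iff)
  then have d': "dim_row (X n) = dim_row A" "dim_col (X n) = dim_row C"
    "dim_row (Y n) = dim_row C" "dim_col (Y n) = dim_col C" for n by auto
  have "(\<lambda>n. \<Sum>a<dim_row C. X n $$ (i, a) * Y n $$ (a, j))
      \<longlonglongrightarrow> (\<Sum>a<dim_row C. A $$ (i, a) * C $$ (a, j))"
    if "i < dim_row A" "j < dim_col C" for i j
    using assms that by (intro tendsto_intros) (auto simp: mat_LIMSEQ_iff)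
  then show ?thesis
    using d' assms(3) unfolding mat_LIMSEQ_iff by (auto intro!: carrier_matI)
qed

lemma mat_LIMSEQ_diff:
  assumes "mat_LIMSEQ X A" "mat_LIMSEQ Y C" "dim_row A = dim_row C" "dim_col A = dim_col C"
  shows "mat_LIMSEQ (\<lambda>n. X n - Y n) (A - C)"
proof -
  have d: "X n \<in> carrier_mat (dim_row C) (dim_col C)" "Y n \<in> carrier_mat (dim_row C) (dim_col C)" for n
    using assms by (auto simp: mat_LIMSEQ_iff)
  then have d': "dim_row (X n) = dim_row C" "dim_col (X n) = dim_col C"
    "dim_row (Y n) = dim_row C" "dim_col (Y n) = dim_col C" for n by auto
  show ?thesis
    using assms d' unfolding mat_LIMSEQ_iff by (auto intro!: carrier_matI tendsto_diff)
qed

lemma mat_LIMSEQ_add: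
  assumes "mat_LIMSEQ X A" "mat_LIMSEQ Y C" "dim_row A = dim_row C" "dim_col A = dim_col C"
  shows "mat_LIMSEQ (\<lambda>n. X n + Y n) (A + C)"
proof -
  have d: "X n \<in> carrier_mat (dim_row C) (dim_col C)" "Y n \<in> carrier_mat (dim_row C) (dim_col C)" for n
    using assms by (auto simp: mat_LIMSEQ_iff)
  then have d': "dim_row (X n) = dim_row C" "dim_col (X n) = dim_col C"
    "dim_row (Y n) = dim_row C" "dim_col (Y n) = dim_col C" for n by auto
  show ?thesis
    using assms d' unfolding mat_LIMSEQ_iff by (auto intro!: carrier_matI tendsto_add)
qed

lemma mat_LIMSEQ_adjoint:
  assumes "mat_LIMSEQ X A"
  shows "mat_LIMSEQ (\<lambda>n. mat_adjoint (X n)) (mat_adjoint A)"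
proof -
  have "X n \<in> carrier_mat (dim_row A) (dim_col A)" for n
    using assms by (auto simp: mat_LIMSEQ_iff)
  then have d: "dim_row (X n) = dim_row A" "dim_col (X n) = dim_col A" for n by auto
  show ?thesis
    using assms d unfolding mat_LIMSEQ_iff by (auto intro!: carrier_matI tendsto_cnj)
qed

lemma mat_LIMSEQ_frob_norm:
  assumes "mat_LIMSEQ X A"
  shows "(\<lambda>n. frob_norm (X n)) \<longlonglongrightarrow> frob_norm A"
proof -
  have "X n \<in> carrier_mat (dim_row A) (dim_col A)" for n
    using assms by (auto simp: mat_LIMSEQ_iff)
  then have d: "dim_row (X n) = dim_row A" "dim_col (X n) = dim_col A" for n by auto
  show ?thesis
    unfolding frob_norm_def d using assms by (intro tendsto_intros) (auto simp: mat_LIMSEQ_iff)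
qed

lemma mat_LIMSEQ_zero_iff:
  assumes "\<And>n. X n \<in> carrier_mat r c"
  shows "mat_LIMSEQ X (0\<^sub>m r c) \<longleftrightarrow> (\<lambda>n. frob_norm (X n)) \<longlonglongrightarrow> 0"
proof -
  have "X n - 0\<^sub>m r c = X n" for n using assms[of n] by (intro eq_matI) auto
  then show ?thesis using assms by (simp add: mat_LIMSEQ_def)
qed

lemma psd_mat_LIMSEQ:
  assumes lim: "mat_LIMSEQ X A" and psd: "\<And>n. psd_mat (X n)"
    and A: "A \<in> carrier_mat k k"
  shows "psd_mat A"
  unfolding psd_mat_iff[OF A]
proof (intro conjI allI)
  have X: "X n \<in> carrier_mat k k" for n using mat_LIMSEQ_carrier[OF lim A] .
  have "(\<lambda>n. mat_adjoint (X n)) = X" using psd_matD(2)[OF psd] by (rule ext)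
  then show "mat_adjoint A = A"
    using mat_LIMSEQ_unique[OF mat_LIMSEQ_adjoint[OF lim]] lim by metis
  fix x :: "nat \<Rightarrow> complex"
  have "(\<lambda>n. Re (\<Sum>i<k. \<Sum>j<k. X n $$ (i, j) * x j * cnj (x i)))
      \<longlonglongrightarrow> Re (\<Sum>i<k. \<Sum>j<k. A $$ (i, j) * x j * cnj (x i))"
    using lim A by (intro tendsto_intros) (auto simp: mat_LIMSEQ_iff)
  moreover have "0 \<le> Re (\<Sum>i<k. \<Sum>j<k. X n $$ (i, j) * x j * cnj (x i))" for n
    using psd[of n] unfolding psd_mat_iff[OF X] by blast
  ultimately show "0 \<le> Re (\<Sum>i<k. \<Sum>j<k. A $$ (i, j) * x j * cnj (x i))"
    by (intro LIMSEQ_le_const) auto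
qed

lemma stiefel_LIMSEQ:
  assumes lim: "mat_LIMSEQ X A" and X: "\<And>n. X n \<in> stiefel k r"
  shows "A \<in> stiefel k r"
proof -
  have A: "A \<in> carrier_mat r k" using mat_LIMSEQ_carrier_limit[OF lim] X by (simp add: stiefel_iff)
  have "mat_LIMSEQ (\<lambda>n. mat_adjoint (X n) * X n) (mat_adjoint A * A)"
    by (intro mat_LIMSEQ_mult mat_LIMSEQ_adjoint lim) simp
  then have "mat_adjoint A * A = 1\<^sub>m k"
    using X mat_LIMSEQ_const mat_LIMSEQ_unique by (fastforce simp: stiefel_iff)
  then show ?thesis using A by (simp add: stiefel_iff)
qed

lemma mat_LIMSEQ_col_block:
  assumes lim: "mat_LIMSEQ X A" and A: "A \<in> carrier_mat n (\<Sum>s<t. w s)" and s: "s < t"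
  shows "mat_LIMSEQ (\<lambda>n. col_block w s (X n)) (col_block w s A)"
proof -
  have "X n \<in> carrier_mat (dim_row A) (dim_col A)" for n
    using lim by (auto simp: mat_LIMSEQ_iff)
  then have d: "dim_row (X n) = dim_row A" for n by auto
  show ?thesis
    using lim d A block_index_less[OF s, of _ w] unfolding mat_LIMSEQ_iff
    by (auto intro!: carrier_matI simp: col_block_def)
qed

text \<open>Only entries inside the box are asked to converge: outside it \<open>mode_mult\<close>
  reads matrix entries beyond the dimensions, which \<open>mat_LIMSEQ\<close> does not
  control.\<close>

definition tensor_LIMSEQ :: "(nat \<Rightarrow> ctensor) \<Rightarrow> ctensor \<Rightarrow> bool" where
  "tensor_LIMSEQ T A \<longleftrightarrow> (\<forall>n. tdims (T n) = tdims A) \<and>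
    (\<forall>is\<in>set (multi_indices (tdims A)). (\<lambda>n. tentry (T n) is) \<longlonglongrightarrow> tentry A is)"

lemma tensor_LIMSEQ_mode_mult:
  assumes T: "tensor_LIMSEQ T A" and X: "mat_LIMSEQ X Y" and l: "l < length (tdims A)"
    and Y: "dim_col Y = tdims A ! l"
  shows "tensor_LIMSEQ (\<lambda>n. mode_mult l (X n) (T n)) (mode_mult l Y A)"
  unfolding tensor_LIMSEQ_def
proof (intro conjI allI ballI)
  have d: "tdims (T n) = tdims A" "dim_row (X n) = dim_row Y" for n
    using T X by (auto simp: tensor_LIMSEQ_def mat_LIMSEQ_iff)
  then show "tdims (mode_mult l (X n) (T n)) = tdims (mode_mult l Y A)" for n by simp
  fix "is" assume "is": "is \<in> set (multi_indices (tdims (mode_mult l Y A)))"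
  then have "is ! l < dim_row Y" using l by (auto simp: multi_indices_iff)
  moreover have "is[l := j] \<in> set (multi_indices (tdims A))" if "j < tdims A ! l" for j
    using multi_indices_update[of "is" "tdims A" l "dim_row Y" j "tdims A ! l"] "is" that l by simp
  ultimately have "(\<lambda>n. \<Sum>j<tdims A ! l. X n $$ (is ! l, j) * tentry (T n) (is[l := j]))
      \<longlonglongrightarrow> (\<Sum>j<tdims A ! l. Y $$ (is ! l, j) * tentry A (is[l := j]))"
    using T X Y by (intro tendsto_intros) (auto simp: tensor_LIMSEQ_def mat_LIMSEQ_iff)
  then show "(\<lambda>n. tentry (mode_mult l (X n) (T n)) is) \<longlonglongrightarrow> tentry (mode_mult l Y A) is"
    by (simp add: mode_mult_def d)
qed

text \<open>Induction on the modes, with the tensor varying since each product changes a dimension;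
  distinctness keeps the dimensions of the pending modes as they were in \<open>A\<close>.\<close>

lemma tensor_LIMSEQ_mode_mults:
  assumes "tensor_LIMSEQ T A" "distinct ls" "s < t"
    and "\<And>l. l \<in> set ls \<Longrightarrow> l < length (tdims A) \<and> mat_LIMSEQ (\<lambda>n. X n l) (Y l) \<and>
      Y l \<in> carrier_mat (tdims A ! l) (\<Sum>s<t. k l s)"
  shows "tensor_LIMSEQ (\<lambda>n. mode_mults k s (X n) ls (T n)) (mode_mults k s Y ls A)"
  using assms
proof (induction ls arbitrary: T A)
  case (Cons l ls)
  have l: "l < length (tdims A)" "mat_LIMSEQ (\<lambda>n. X n l) (Y l)"
    "Y l \<in> carrier_mat (tdims A ! l) (\<Sum>s<t. k l s)"
    using Cons.prems(4)[of l] by auto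
  have "tensor_LIMSEQ (\<lambda>n. mode_mult l (mat_adjoint (col_block (k l) s (X n l))) (T n))
      (mode_mult l (mat_adjoint (col_block (k l) s (Y l))) A)"
    using l by (intro tensor_LIMSEQ_mode_mult Cons.prems(1) mat_LIMSEQ_adjoint
      mat_LIMSEQ_col_block[OF l(2,3) Cons.prems(3)]) auto
  then have "tensor_LIMSEQ (\<lambda>n. mode_mults k s (X n) ls (mode_mult l (mat_adjoint (col_block (k l) s (X n l))) (T n)))
      (mode_mults k s Y ls (mode_mult l (mat_adjoint (col_block (k l) s (Y l))) A))"
    using Cons.prems by (intro Cons.IH) (auto simp: nth_list_update)
  then show ?case by (simp add: mode_mults_def)
qed (simp add: mode_mults_def)

lemma mat_LIMSEQ_unfolding_mat:
  assumes T: "tensor_LIMSEQ T A" and l: "l < length (tdims A)"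
  shows "mat_LIMSEQ (\<lambda>n. unfolding_mat l (T n)) (unfolding_mat l A)"
proof -
  let ?cs = "multi_indices ((tdims A)[l := 1])"
  have d: "tdims (T n) = tdims A" for n
    using T by (auto simp: tensor_LIMSEQ_def)
  have "(?cs ! c)[l := i] \<in> set (multi_indices (tdims A))" if "c < length ?cs" "i < tdims A ! l" for c i
    using multi_indices_update[of "?cs ! c" "tdims A" l 1 i "tdims A ! l"] that l by simp
  then have "(\<lambda>n. tentry (T n) ((?cs ! c)[l := i])) \<longlonglongrightarrow> tentry A ((?cs ! c)[l := i])"
    if "c < length ?cs" "i < tdims A ! l" for c i
    using T that by (simp add: tensor_LIMSEQ_def)
  then show ?thesis
    unfolding mat_LIMSEQ_iff by (auto simp: unfolding_mat_def Let_def d)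
qed

context
  fixes t :: nat and k :: "nat \<Rightarrow> nat \<Rightarrow> nat" and B :: ctensor
    and X :: "nat \<Rightarrow> nat \<Rightarrow> complex mat" and Y :: "nat \<Rightarrow> complex mat"
  assumes lim: "tuple_LIMSEQ (length (tdims B)) X Y"
    and Y: "\<And>l. l < length (tdims B) \<Longrightarrow> Y l \<in> carrier_mat (tdims B ! l) (\<Sum>s<t. k l s)"
begin

lemma tensor_LIMSEQ_mode_mults_tuple:
  assumes "distinct ls" "set ls \<subseteq> {..<length (tdims B)}" "s < t"
  shows "tensor_LIMSEQ (\<lambda>n. mode_mults k s (X n) ls B) (mode_mults k s Y ls B)"
  using assms lim Y by (intro tensor_LIMSEQ_mode_mults) (auto simp: tensor_LIMSEQ_def tuple_LIMSEQ_def)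

lemma objective_LIMSEQ: "(\<lambda>n. objective t k B (X n)) \<longlonglongrightarrow> objective t k B Y"
  unfolding objective_def
proof (rule tendsto_sum)
  fix s assume "s \<in> {..<t}"
  then have *: "tensor_LIMSEQ (\<lambda>n. mode_mults k s (X n) [0..<length (tdims B)] B)
      (mode_mults k s Y [0..<length (tdims B)] B)"
    by (intro tensor_LIMSEQ_mode_mults_tuple) auto
  then show "(\<lambda>n. (tensor_norm (mode_mults k s (X n) [0..<length (tdims B)] B))\<^sup>2)
      \<longlonglongrightarrow> (tensor_norm (mode_mults k s Y [0..<length (tdims B)] B))\<^sup>2"
    unfolding tensor_norm_def tensor_LIMSEQ_def by (auto intro!: tendsto_intros)
qed

lemma grad_LIMSEQ:
  assumes l: "l < length (tdims B)"
  shows "mat_LIMSEQ (\<lambda>n. grad t k B l (X n)) (grad t k B l Y)"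
proof -
  let ?n = "tdims B ! l" and ?w = "\<Sum>s<t. k l s"
  have Xl: "mat_LIMSEQ (\<lambda>n. X n l) (Y l)" using lim l by (auto simp: tuple_LIMSEQ_def)
  have Xc: "X n l \<in> carrier_mat ?n ?w" for n
    using mat_LIMSEQ_carrier[OF Xl Y[OF l]] .
  have G: "grad t k B l (X n) \<in> carrier_mat ?n ?w" "grad t k B l Y \<in> carrier_mat ?n ?w" for n
    using grad_carrier[OF l, where P = "X n" and t = t and k = k, OF Xc]
      grad_carrier[OF l, where P = Y and t = t and k = k, OF Y[OF l]] .
  have "mat_LIMSEQ (\<lambda>n. H_mat k B (X n) l s * col_block (k l) s (X n l)) (H_mat k B Y l s * col_block (k l) s (Y l))"
    if s: "s < t" for s
    unfolding H_mat_def C_mat_def using s l Y[OF l]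
    by (intro mat_LIMSEQ_mult mat_LIMSEQ_adjoint mat_LIMSEQ_unfolding_mat
        tensor_LIMSEQ_mode_mults_tuple mat_LIMSEQ_col_block[OF Xl])
      (auto simp: tdims_mode_mults unfolding_mat_def Let_def)
  note HX = this
  have HY: "H_mat k B Y l s * col_block (k l) s (Y l) \<in> carrier_mat ?n (k l s)" for s
    using l Y by (intro mult_carrier_mat[OF H_mat_carrier] col_block_carrier) auto
  have block: "grad t k B l Z $$ (i, (\<Sum>r<s. k l r) + c) = 2 * (H_mat k B Z l s * col_block (k l) s (Z l)) $$ (i, c)"
    if "Z l \<in> carrier_mat ?n ?w" "i < ?n" "s < t" "c < k l s" for Z i s c
  proof -
    have "grad t k B l Z $$ (i, (\<Sum>r<s. k l r) + c) = col_block (k l) s (grad t k B l Z) $$ (i, c)"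
      using that grad_carrier[OF l, where P = Z and t = t and k = k, OF that(1)] by (simp add: col_block_def)
    then show ?thesis
      unfolding col_block_grad[OF l, where P = Z and t = t and k = k, OF that(1,3)] using that l by (simp add: H_mat_def)
  qed
  show ?thesis
    unfolding mat_LIMSEQ_iff
  proof (intro conjI allI impI)
    show "grad t k B l (X n) \<in> carrier_mat (dim_row (grad t k B l Y)) (dim_col (grad t k B l Y))" for n
      using G by (metis carrier_matD)
    fix i j assume "i < dim_row (grad t k B l Y)" "j < dim_col (grad t k B l Y)"
    then have i: "i < ?n" and "j < ?w" using G(2) by auto
    then obtain s c where sc: "s < t" "c < k l s" "j = (\<Sum>r<s. k l r) + c"
      using block_index_exists by metis
    have "(\<lambda>n. (H_mat k B (X n) l s * col_block (k l) s (X n l)) $$ (i, c))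
        \<longlonglongrightarrow> (H_mat k B Y l s * col_block (k l) s (Y l)) $$ (i, c)"
      using HX[OF sc(1)] HY[of s] i sc(2) unfolding mat_LIMSEQ_iff by auto
    then show "(\<lambda>n. grad t k B l (X n) $$ (i, j)) \<longlonglongrightarrow> grad t k B l Y $$ (i, j)"
      unfolding sc(3) block[of "X n" for n, OF Xc i sc(1,2)] block[of Y, OF Y[OF l] i sc(1,2)]
      by (intro tendsto_intros)
  qed
qed

end

section \<open>One polar step\<close>

text \<open>Orthonormal columns make the two pure terms equal:
  \<open>\<langle>Q L, Q\<rangle> = tr L = \<langle>P L, P\<rangle>\<close>. The cross terms are
  conjugate to each other because \<open>L\<close> is Hermitian, which leaves twice the real part of
  \<open>\<langle>Q L, Q - P\<rangle>\<close>.\<close>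

lemma polar_increment:
  assumes Q: "Q \<in> stiefel k n" and P: "P \<in> stiefel k n"
    and L: "psd_mat L" "L \<in> carrier_mat k k"
  shows "Re (mat_inner ((Q - P) * L) (Q - P)) = 2 * Re (mat_inner (Q * L) (Q - P))"
proof -
  have c: "Q \<in> carrier_mat n k" "P \<in> carrier_mat n k" using Q P by (auto simp: stiefel_iff)
  have QL: "Q * L \<in> carrier_mat n k" and PL: "P * L \<in> carrier_mat n k" using c L by auto
  have trace: "mat_inner (X * L) X = mat_inner L (1\<^sub>m k)" if "X \<in> stiefel k n" for X
    using mat_inner_mult_left[of L k k X n X] that L by (simp add: stiefel_iff)
  have cross: "mat_inner (P * L) Q = cnj (mat_inner (Q * L) P)"
    using mat_inner_mult_right[OF c(2) L(2) c(1)] psd_matD(2)[OF L(1)] mat_inner_commute[OF QL c(2)]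
    by simp
  have DL: "(Q - P) * L = Q * L - P * L"
    by (rule minus_mult_distrib_mat[OF c L(2)])
  have "mat_inner ((Q - P) * L) (Q - P)
      = mat_inner (Q * L) Q - mat_inner (Q * L) P - (mat_inner (P * L) Q - mat_inner (P * L) P)"
    unfolding DL using mat_inner_diff_left[OF QL PL] mat_inner_diff_right[OF c QL]
      mat_inner_diff_right[OF c PL] by simp
  then show ?thesis
    using mat_inner_diff_right[OF c QL] cross trace[OF Q] trace[OF P] by simp
qed

text \<open>The projector \<open>I - P P^H\<close> annihilates \<open>P\<close>, so it has the same
  value at \<open>Q\<close> as at \<open>Q - P\<close>, and it does not increase the norm.\<close>

lemma projection_defect_le:
  assumes Q: "Q \<in> stiefel k n" and P: "P \<in> stiefel k n"
  shows "frob_norm (Q - P * (mat_adjoint P * Q)) \<le> frob_norm (Q - P)"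
proof (rule power2_le_imp_le)
  have c: "Q \<in> carrier_mat n k" "P \<in> carrier_mat n k" "mat_adjoint P \<in> carrier_mat k n"
    using Q P by (auto simp: stiefel_iff)
  have PQ: "mat_adjoint P * Q \<in> carrier_mat k k" using c by auto
  have D: "Q - P \<in> carrier_mat n k" using c by (intro minus_carrier_mat)
  have "P * (mat_adjoint P * (Q - P)) = P * (mat_adjoint P * Q - 1\<^sub>m k)"
    using mult_minus_distrib_mat[OF c(3,1,2)] P by (simp add: stiefel_iff)
  also have "\<dots> = P * (mat_adjoint P * Q) - P"
    using mult_minus_distrib_mat[OF c(2) PQ one_carrier_mat] right_mult_one_mat[OF c(2)] by simp
  finally have "Q - P - P * (mat_adjoint P * (Q - P)) = Q - P * (mat_adjoint P * Q)"
    using c by (intro eq_matI) auto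
  then show "(frob_norm (Q - P * (mat_adjoint P * Q)))\<^sup>2 \<le> (frob_norm (Q - P))\<^sup>2"
    using frob_norm_projection[OF P D] by simp
qed simp

text \<open>The residual of \<open>Q L\<close> is the residual of \<open>Q\<close> times
  \<open>L\<close>, and \<open>\<parallel>L\<parallel> = \<parallel>Q L\<parallel>\<close>, so
  dividing removes \<open>L\<close>.\<close>

lemma polar_residual_le:
  assumes Q: "Q \<in> stiefel k n" and P: "P \<in> stiefel k n" and L: "L \<in> carrier_mat k k"
  shows "(frob_norm (Q * L - P * (mat_adjoint P * (Q * L))))\<^sup>2 / (frob_norm (Q * L))\<^sup>2
    \<le> (frob_norm (Q - P * (mat_adjoint P * Q)))\<^sup>2"
proof -
  have c: "Q \<in> carrier_mat n k" "P \<in> carrier_mat n k" "mat_adjoint P \<in> carrier_mat k n"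
    using Q P by (auto simp: stiefel_iff)
  let ?R = "Q - P * (mat_adjoint P * Q)"
  have PQ: "mat_adjoint P * Q \<in> carrier_mat k k" using c by auto
  have R: "?R \<in> carrier_mat n k" using c PQ by (intro minus_carrier_mat) auto
  have "Q * L - P * (mat_adjoint P * (Q * L)) = ?R * L"
    using minus_mult_distrib_mat[OF c(1) mult_carrier_mat[OF c(2) PQ] L]
      assoc_mult_mat[OF c(2) PQ L] assoc_mult_mat[OF c(3,1) L] by simp
  then have "frob_norm (Q * L - P * (mat_adjoint P * (Q * L))) \<le> frob_norm ?R * frob_norm (Q * L)"
    using frob_norm_mult_le[OF R L] frob_norm_stiefel_mult[OF Q L] by simp
  then have "(frob_norm (Q * L - P * (mat_adjoint P * (Q * L))))\<^sup>2 \<le> (frob_norm ?R)\<^sup>2 * (frob_norm (Q * L))\<^sup>2"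
    by (metis frob_norm_nonneg power_mono power_mult_distrib)
  \<comment> \<open>For \<open>Q L = 0\<close> the quotient is a division by zero, hence 0, in
    agreement with the convention for vanishing gradients.\<close>
  then show ?thesis
    by (cases "frob_norm (Q * L) = 0") (simp_all add: divide_le_eq)
qed

text \<open>The limit is obtained from \<open>(Q - P) L \<longlonglongrightarrow> 0\<close> alone, so no convergence of the
  polar factors \<open>Q\<close> has to be assumed.\<close>

lemma polar_limit:
  assumes Q: "\<And>i. Q i \<in> stiefel k n" and P: "\<And>i. P i \<in> stiefel k n"
    and L: "\<And>i. psd_mat (L i)" "\<And>i. L i \<in> carrier_mat k k"
    and P_lim: "mat_LIMSEQ P A" and H_lim: "mat_LIMSEQ (\<lambda>i. Q i * L i) G"
    and gain: "(\<lambda>i. Re (mat_inner ((Q i - P i) * L i) (Q i - P i))) \<longlonglongrightarrow> 0"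
  shows "G = A * (mat_adjoint A * G)" "psd_mat (mat_adjoint A * G)"
    "vec_space.rank n G = k \<Longrightarrow> mat_LIMSEQ Q A"
proof -
  have c: "Q i \<in> carrier_mat n k" "P i \<in> carrier_mat n k" for i using Q P by (auto simp: stiefel_iff)
  have A: "A \<in> carrier_mat n k" by (rule mat_LIMSEQ_carrier_limit[OF P_lim c(2)])
  have G: "G \<in> carrier_mat n k"
    by (rule mat_LIMSEQ_carrier_limit[OF H_lim mult_carrier_mat[OF c(1) L(2)]])
  define D where "D i = Q i - P i" for i
  have D: "D i \<in> carrier_mat n k" for i unfolding D_def by (rule minus_carrier_mat[OF c(2)])
  have DL: "D i * L i \<in> carrier_mat n k" for i by (rule mult_carrier_mat[OF D L(2)])
  have DL_eq: "D i * L i = Q i * L i - P i * L i" for i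
    unfolding D_def by (rule minus_mult_distrib_mat[OF c L(2)])
  have "(\<lambda>i. frob_norm (Q i * L i) * Re (mat_inner (D i * L i) (D i))) \<longlonglongrightarrow> frob_norm G * 0"
    unfolding D_def by (intro tendsto_mult gain mat_LIMSEQ_frob_norm[OF H_lim])
  then have "(\<lambda>i. sqrt (frob_norm (Q i * L i) * Re (mat_inner (D i * L i) (D i)))) \<longlonglongrightarrow> 0"
    using tendsto_real_sqrt by fastforce
  \<comment> \<open>The estimate has \<open>\<parallel>L\<parallel>\<close> as its factor; it is
    replaced by \<open>\<parallel>Q L\<parallel>\<close>, whose limit is known, while that of
    \<open>L\<close> is not yet.\<close>
  moreover have "frob_norm (D i * L i) \<le> sqrt (frob_norm (Q i * L i) * Re (mat_inner (D i * L i) (D i)))" for i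
    using frob_norm_psd_mult_sq_le[OF L D, of i] frob_norm_stiefel_mult[OF Q L(2)]
    by (intro real_le_rsqrt) simp
  ultimately have "(\<lambda>i. frob_norm (D i * L i)) \<longlonglongrightarrow> 0"
    by (rule LIMSEQ_0_comparison) simp
  then have DL_lim: "mat_LIMSEQ (\<lambda>i. D i * L i) (0\<^sub>m n k)"
    unfolding mat_LIMSEQ_zero_iff[OF DL] .
  define M where "M = mat_adjoint A * G"
  have M: "M \<in> carrier_mat k k" using A G by (auto simp: M_def)
  \<comment> \<open>From \<open>P L = Q L - D L\<close>, multiplied by \<open>P^H\<close>.
    Everything on the right converges, so \<open>L\<close> tends to \<open>M\<close>.\<close>
  have "L i = mat_adjoint (P i) * (Q i * L i) - mat_adjoint (P i) * (D i * L i)" for i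
  proof -
    have PL: "P i * L i \<in> carrier_mat n k" and QL: "Q i * L i \<in> carrier_mat n k"
      by (rule mult_carrier_mat[OF c(2) L(2)], rule mult_carrier_mat[OF c(1) L(2)])
    have "mat_adjoint (P i) * (D i * L i)
        = mat_adjoint (P i) * (Q i * L i) - mat_adjoint (P i) * (P i * L i)"
      unfolding DL_eq by (rule mult_minus_distrib_mat[OF mat_adjoint_carrier[OF c(2)] QL PL])
    then show ?thesis
      using stiefel_adjoint_mult_mult[OF P L(2)] L(2)[of i]
        mult_carrier_mat[OF mat_adjoint_carrier[OF c(2)[of i]] QL]
      by (intro eq_matI) auto
  qed
  moreover have "mat_LIMSEQ (\<lambda>i. mat_adjoint (P i) * (Q i * L i) - mat_adjoint (P i) * (D i * L i))
      (M - mat_adjoint A * 0\<^sub>m n k)"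
    unfolding M_def using A G
    by (intro mat_LIMSEQ_diff mat_LIMSEQ_mult mat_LIMSEQ_adjoint P_lim H_lim DL_lim) auto
  moreover have "M - mat_adjoint A * 0\<^sub>m n k = M"
    using right_mult_zero_mat[OF mat_adjoint_carrier[OF A], of k] M by (intro eq_matI) auto
  ultimately have L_lim: "mat_LIMSEQ L M" by simp
  show psd: "psd_mat (mat_adjoint A * G)"
    using psd_mat_LIMSEQ[OF L_lim L(1) M] by (simp add: M_def)
  have "mat_LIMSEQ (\<lambda>i. D i * L i) (G - A * M)"
    unfolding DL_eq using A G M by (intro mat_LIMSEQ_diff mat_LIMSEQ_mult H_lim P_lim L_lim) auto
  then have "G - A * M = 0\<^sub>m n k" by (rule mat_LIMSEQ_unique[OF _ DL_lim])
  then have "G = A * M"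
  proof (intro eq_matI)
    fix i j assume z: "G - A * M = 0\<^sub>m n k" and "i < dim_row (A * M)" "j < dim_col (A * M)"
    then have ij: "i < n" "j < k" using A M by auto
    have "(G - A * M) $$ (i, j) = 0" unfolding z using ij by simp
    then show "G $$ (i, j) = (A * M) $$ (i, j)" using ij A M by simp
  qed (use G A M in auto)
  then show "G = A * (mat_adjoint A * G)" by (simp only: M_def)
  assume rank: "vec_space.rank n G = k"
  have "det M \<noteq> 0"
  proof
    assume "det M = 0"
    then obtain v where v: "v \<in> carrier_vec k" "v \<noteq> 0\<^sub>v k" "M *\<^sub>v v = 0\<^sub>v k"
      using det_0_iff_vec_prod_zero_field[OF M] by blast
    have "G *\<^sub>v v = 0\<^sub>v n"
      unfolding \<open>G = A * M\<close> assoc_mult_mat_vec[OF A M v(1)] v(3) using A by (intro eq_vecI) auto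
    then show False using full_rank_kernel[OF G rank v(1)] v(2) by blast
  qed
  then obtain M' where M': "M' \<in> carrier_mat k k" "M * M' = 1\<^sub>m k"
    using det_nonzero_obtain_inverse[OF M] by blast
  \<comment> \<open>\<open>\<parallel>Q - P\<parallel>^2 = 2 k - 2 Re \<langle>Q,
    P\<rangle>\<close>, and the inner product is at most \<open>k\<close> in absolute value.
    Boundedness is needed to get \<open>D (L - M)\<close> to 0 from \<open>L - M\<close> tending to
    0.\<close>
  have D_bound: "frob_norm (D i) \<le> 2 * sqrt (real k)" for i
  proof (rule power2_le_imp_le)
    have "mat_inner (D i) (D i)
        = mat_inner (Q i) (Q i) - mat_inner (Q i) (P i) - (mat_inner (P i) (Q i) - mat_inner (P i) (P i))"
      unfolding D_def using mat_inner_diff_left[OF c] mat_inner_diff_right[OF c c(1)]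
        mat_inner_diff_right[OF c c(2)] by simp
    then have "Re (mat_inner (D i) (D i)) = 2 * real k - 2 * Re (mat_inner (Q i) (P i))"
      using mat_inner_commute[OF c] frob_norm_stiefel[OF Q] frob_norm_stiefel[OF P]
      by (simp add: Re_mat_inner_self)
    moreover have "\<bar>Re (mat_inner (Q i) (P i))\<bar> \<le> frob_norm (Q i) * frob_norm (P i)"
      by (rule order_trans[OF abs_Re_le_cmod mat_inner_bound[OF c]])
    moreover have "frob_norm (Q i) = sqrt (real k)" "frob_norm (P i) = sqrt (real k)"
      using frob_norm_stiefel[OF Q] frob_norm_stiefel[OF P]
      by (metis frob_norm_nonneg real_sqrt_unique)+
    ultimately show "(frob_norm (D i))\<^sup>2 \<le> (2 * sqrt (real k))\<^sup>2"
      by (simp add: Re_mat_inner_self power_mult_distrib)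
  qed simp
  have "(\<lambda>i. 2 * sqrt (real k) * frob_norm (L i - M)) \<longlonglongrightarrow> 2 * sqrt (real k) * 0"
    using L_lim by (intro tendsto_mult tendsto_const) (simp add: mat_LIMSEQ_def)
  then have "(\<lambda>i. 2 * sqrt (real k) * frob_norm (L i - M)) \<longlonglongrightarrow> 0" by simp
  moreover have LM: "L i - M \<in> carrier_mat k k" for i by (rule minus_carrier_mat[OF M])
  have "frob_norm (D i * (L i - M)) \<le> 2 * sqrt (real k) * frob_norm (L i - M)" for i
    by (rule order_trans[OF frob_norm_mult_le[OF D LM]]) (intro mult_right_mono D_bound frob_norm_nonneg)
  ultimately have "(\<lambda>i. frob_norm (D i * (L i - M))) \<longlonglongrightarrow> 0"
    by (rule LIMSEQ_0_comparison) simp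
  then have "mat_LIMSEQ (\<lambda>i. D i * (L i - M)) (0\<^sub>m n k)"
    using mat_LIMSEQ_zero_iff[of "\<lambda>i. D i * (L i - M)" n k] mult_carrier_mat[OF D LM] by simp
  \<comment> \<open>\<open>D L - D (L - M) = D M\<close>, and \<open>M'\<close> cancels
    \<open>M\<close>, so this sequence is \<open>Q\<close> itself, written in terms of sequences
    with known limits.\<close>
  then have "mat_LIMSEQ (\<lambda>i. P i + (D i * L i - D i * (L i - M)) * M') (A + (0\<^sub>m n k - 0\<^sub>m n k) * M')"
    using A M'(1) by (intro mat_LIMSEQ_add mat_LIMSEQ_mult mat_LIMSEQ_diff mat_LIMSEQ_const P_lim DL_lim) auto
  moreover have "P i + (D i * L i - D i * (L i - M)) * M' = Q i" for i
  proof -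
    have DM: "D i * M \<in> carrier_mat n k" by (rule mult_carrier_mat[OF D M])
    have "D i * L i - D i * (L i - M) = D i * M"
      unfolding mult_minus_distrib_mat[OF D L(2) M] using DL[of i] DM by (intro eq_matI) auto
    moreover have "D i * M * M' = D i"
      using assoc_mult_mat[OF D M M'(1)] M'(2) right_mult_one_mat[OF D] by simp
    moreover have "P i + D i = Q i"
      unfolding D_def using c[of i] by (intro eq_matI) auto
    ultimately show ?thesis by simp
  qed
  moreover have "A + (0\<^sub>m n k - 0\<^sub>m n k) * M' = A"
  proof -
    have "(0\<^sub>m n k - 0\<^sub>m n k) = (0\<^sub>m n k :: complex mat)" by (intro eq_matI) auto
    then show ?thesis using left_mult_zero_mat[OF M'(1), of n] right_add_zero_mat[OF A] by (simp only:)
  qed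
  ultimately show "mat_LIMSEQ Q A" by simp
qed

section \<open>Compactness\<close>

lemma bounded_real_seq_subseq:
  fixes x :: "nat \<Rightarrow> real"
  assumes "\<And>n. \<bar>x n\<bar> \<le> M"
  obtains r :: "nat \<Rightarrow> nat" where "strict_mono r" "convergent (\<lambda>n. x (r n))"
proof -
  obtain r :: "nat \<Rightarrow> nat" where r: "strict_mono r" "monoseq (\<lambda>n. x (r n))"
    using seq_monosub by blast
  have "Bseq (\<lambda>n. x (r n))" using assms by (intro BseqI'[of _ M]) simp
  then show ?thesis using that[OF r(1)] r(2) Bseq_monoseq_convergent by blast
qed

lemma bounded_complex_seq_subseq:
  fixes x :: "nat \<Rightarrow> complex"
  assumes "\<And>n. cmod (x n) \<le> M"
  obtains r :: "nat \<Rightarrow> nat" where "strict_mono r" "convergent (\<lambda>n. x (r n))"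
proof -
  obtain p :: "nat \<Rightarrow> nat" where p: "strict_mono p" "convergent (\<lambda>n. Re (x (p n)))"
    using bounded_real_seq_subseq[of "\<lambda>n. Re (x n)" M] assms abs_Re_le_cmod order_trans by metis
  obtain q :: "nat \<Rightarrow> nat" where q: "strict_mono q" "convergent (\<lambda>n. Im (x (p (q n))))"
    using bounded_real_seq_subseq[of "\<lambda>n. Im (x (p n))" M] assms abs_Im_le_cmod order_trans by metis
  have "convergent (\<lambda>n. Re (x (p (q n))))"
    using convergent_subseq_convergent[OF p(2) q(1)] by (simp add: o_def)
  then obtain a b where "(\<lambda>n. Re (x (p (q n)))) \<longlonglongrightarrow> a" "(\<lambda>n. Im (x (p (q n)))) \<longlonglongrightarrow> b"
    using q(2) by (auto simp: convergent_def)
  then have "(\<lambda>n. Complex (Re (x (p (q n)))) (Im (x (p (q n))))) \<longlonglongrightarrow> Complex a b"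
    by (rule tendsto_Complex)
  then have "convergent (\<lambda>n. x ((p \<circ> q) n))"
    by (auto simp: convergent_def)
  then show ?thesis
    using that[of "p \<circ> q"] strict_mono_o[OF p(1) q(1)] by simp
qed

text \<open>With finitely many indices the subsequence can be refined once per index; refinement
  preserves the convergence already obtained.\<close>

lemma bounded_family_subseq:
  fixes x :: "nat \<Rightarrow> 'i \<Rightarrow> complex"
  assumes "finite I" "\<And>n i. i \<in> I \<Longrightarrow> cmod (x n i) \<le> M i"
  shows "\<exists>r :: nat \<Rightarrow> nat. strict_mono r \<and> (\<forall>i\<in>I. convergent (\<lambda>n. x (r n) i))"
  using assms
proof (induction I)
  case empty
  show ?case by (intro exI[of _ id]) (simp add: strict_mono_def)
next
  case (insert a I)
  then obtain p :: "nat \<Rightarrow> nat" where p: "strict_mono p" "\<forall>i\<in>I. convergent (\<lambda>n. x (p n) i)"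
    by blast
  obtain q :: "nat \<Rightarrow> nat" where q: "strict_mono q" "convergent (\<lambda>n. x (p (q n)) a)"
    using bounded_complex_seq_subseq[of "\<lambda>n. x (p n) a" "M a"] insert.prems by blast
  have "convergent (\<lambda>n. x (p (q n)) i)" if "i \<in> I" for i
    using convergent_subseq_convergent[of "\<lambda>n. x (p n) i", OF _ q(1)] p(2) that by (simp add: o_def)
  moreover have "strict_mono (\<lambda>n. p (q n))"
    using strict_mono_o[OF p(1) q(1)] by (simp add: o_def)
  ultimately show ?case using q(2) by (intro exI[of _ "\<lambda>n. p (q n)"]) auto
qed

text \<open>The norm of a factor is \<open>sqrt (K l)\<close>, which bounds each of its entries, and
  a tuple has finitely many entries. The compactness serves twice: to bound the objective, and to
  extract a limit from the exit indices in the isolated case.\<close>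

lemma stiefel_tuple_subseq:
  assumes X: "\<And>j l. l < m \<Longrightarrow> X j l \<in> stiefel (K l) (n l)"
  obtains r :: "nat \<Rightarrow> nat" and Y where "strict_mono r" "tuple_LIMSEQ m (\<lambda>i. X (r i)) Y"
proof -
  define I where "I = (SIGMA l:{..<m}. {..<n l} \<times> {..<K l})"
  have "finite I" by (simp add: I_def)
  moreover have "cmod (case p of (l, ij) \<Rightarrow> X j l $$ ij) \<le> sqrt (real (K (fst p)))" if "p \<in> I" for j p
  proof -
    obtain l a b where p: "p = (l, a, b)" by (cases p)
    then have p: "p = (l, a, b)" "l < m" "a < n l" "b < K l"
      using that by (auto simp: I_def)
    have "cmod (X j l $$ (a, b)) \<le> frob_norm (X j l)"
      using X[OF p(2), of j] p by (intro norm_entry_le_frob_norm) (auto simp: stiefel_iff)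
    also have "\<dots> = sqrt (real (K l))"
      using frob_norm_stiefel[OF X[OF p(2)]] by (metis frob_norm_nonneg real_sqrt_unique)
    finally show ?thesis by (simp add: p)
  qed
  ultimately obtain r :: "nat \<Rightarrow> nat" where r: "strict_mono r"
    "\<forall>p\<in>I. convergent (\<lambda>i. case p of (l, ij) \<Rightarrow> X (r i) l $$ ij)"
    using bounded_family_subseq[of I "\<lambda>j p. case p of (l, ij) \<Rightarrow> X j l $$ ij" "\<lambda>p. sqrt (real (K (fst p)))"]
    by blast
  define Y where "Y l = mat (n l) (K l) (\<lambda>ij. lim (\<lambda>i. X (r i) l $$ ij))" for l
  have "mat_LIMSEQ (\<lambda>i. X (r i) l) (Y l)" if l: "l < m" for l
  proof -
    have "X (r i) l \<in> carrier_mat (n l) (K l)" for i using X[OF l] by (simp add: stiefel_iff)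
    moreover have "(\<lambda>i. X (r i) l $$ (a, b)) \<longlonglongrightarrow> lim (\<lambda>i. X (r i) l $$ (a, b))"
      if "a < n l" "b < K l" for a b
      using bspec[OF r(2), of "(l, a, b)"] l that by (simp add: I_def convergent_LIMSEQ_iff)
    ultimately show ?thesis by (simp add: mat_LIMSEQ_iff Y_def)
  qed
  then show ?thesis using that[OF r(1), of Y] unfolding tuple_LIMSEQ_def by blast
qed

section \<open>The alternating iteration\<close>

locale alternating_npdo =
  fixes m t :: nat
    and n :: "nat \<Rightarrow> nat"
    and k :: "nat \<Rightarrow> nat \<Rightarrow> nat"
    and B :: ctensor
    and P :: "nat \<Rightarrow> nat \<Rightarrow> complex mat"
    and Hhat :: "nat \<Rightarrow> nat \<Rightarrow> complex mat"
  assumes t: "t \<ge> 1"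
    and dims: "tdims B = map n [0..<m]"
    and k_pos: "\<And>l s. l < m \<Longrightarrow> s < t \<Longrightarrow> k l s \<ge> 1"
    and k_le: "\<And>l. l < m \<Longrightarrow> (\<Sum>s<t. k l s) \<le> n l"
    and init: "\<And>l. l < m \<Longrightarrow> P 0 l \<in> stiefel (\<Sum>s<t. k l s) (n l)"
    and Hhat: "\<And>j l. l < m \<Longrightarrow> Hhat j l = grad t k B l (mixed l (P (Suc j)) (P j))"
    and iter: "\<And>j l. l < m \<Longrightarrow> orthonormal_polar_factor (P (Suc j) l) (Hhat j l)"
begin

abbreviation K :: "nat \<Rightarrow> nat" where "K l \<equiv> \<Sum>s<t. k l s"

lemma order_B [simp]: "length (tdims B) = m"
  by (simp add: dims)

lemma dim_B [simp]: "l < m \<Longrightarrow> tdims B ! l = n l"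
  by (simp add: dims)

lemma K_pos: "l < m \<Longrightarrow> 0 < K l"
  using t k_pos[of l 0] member_le_sum[of 0 "{..<t}" "k l"] by fastforce

lemma Hhat_carrierI:
  assumes l: "l < m" and "P j l \<in> carrier_mat (n l) (K l)"
  shows "Hhat j l \<in> carrier_mat (n l) (K l)"
  using grad_carrier[where B = B and l = l and t = t and k = k and P = "mixed l (P (Suc j)) (P j)"] assms
  by (simp add: Hhat mixed_def)

text \<open>The shape of the gradient for mode \<open>l\<close> depends on the old factor of that
  mode alone, so the induction on \<open>j\<close> runs separately in each mode.\<close>

lemma P_stiefel:
  assumes l: "l < m"
  shows "P j l \<in> stiefel (K l) (n l)"
proof (induction j)
  case 0
  show ?case by (rule init[OF l])
next
  case (Suc j)
  then have "Hhat j l \<in> carrier_mat (n l) (K l)"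
    using l by (intro Hhat_carrierI) (auto simp: stiefel_iff)
  then show ?case using iter[OF l, of j] by (auto simp: orthonormal_polar_factor_def)
qed

lemma P_carrier: "l < m \<Longrightarrow> P j l \<in> carrier_mat (n l) (K l)"
  using P_stiefel by (simp add: stiefel_iff)

lemma Hhat_carrier: "l < m \<Longrightarrow> Hhat j l \<in> carrier_mat (n l) (K l)"
  by (intro Hhat_carrierI P_carrier)

text \<open>In \<open>H = Q L\<close> the factor \<open>L\<close> is determined by \<open>Q\<close>,
  as \<open>Q^H H\<close>; this names it without a choice.\<close>

definition Lam :: "nat \<Rightarrow> nat \<Rightarrow> complex mat" where
  "Lam j l = mat_adjoint (P (Suc j) l) * Hhat j l"

lemma Hhat_polar:
  assumes l: "l < m"
  shows "Hhat j l = P (Suc j) l * Lam j l" "psd_mat (Lam j l)" "Lam j l \<in> carrier_mat (K l) (K l)"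
proof -
  obtain L where L: "L \<in> carrier_mat (K l) (K l)" "psd_mat L" "Hhat j l = P (Suc j) l * L"
    using iter[OF l, of j] Hhat_carrier[OF l, of j] by (auto simp: orthonormal_polar_factor_def)
  have "Lam j l = L"
    unfolding Lam_def L(3) by (rule stiefel_adjoint_mult_mult[OF P_stiefel[OF l] L(1)])
  then show "Hhat j l = P (Suc j) l * Lam j l" "psd_mat (Lam j l)" "Lam j l \<in> carrier_mat (K l) (K l)"
    using L by auto
qed

section \<open>Monotonicity of the objective and summability of its increments\<close>

definition gain :: "nat \<Rightarrow> real" where
  "gain j = objective t k B (P (Suc j)) - objective t k B (P j)"

text \<open>By \<open>polar_increment\<close> this is twice the first-order increase
  \<open>Re \<langle>H, Q - P\<rangle>\<close> of the objective in the update of mode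
  \<open>l\<close>.\<close>

definition defect :: "nat \<Rightarrow> nat \<Rightarrow> real" where
  "defect j l = Re (mat_inner ((P (Suc j) l - P j l) * Lam j l) (P (Suc j) l - P j l))"

lemma defect_nonneg: "l < m \<Longrightarrow> 0 \<le> defect j l"
  unfolding defect_def by (rule psd_mat_inner_nonneg[OF Hhat_polar(2,3) minus_carrier_mat[OF P_carrier]])

lemma defect_le_stage_increment:
  assumes l: "l < m"
  shows "defect j l \<le> 2 * (objective t k B (mixed (Suc l) (P (Suc j)) (P j))
    - objective t k B (mixed l (P (Suc j)) (P j)))"
proof -
  \<comment> \<open>\<open>mixed l\<close> is the tuple just before mode \<open>l\<close> is
    updated, \<open>mixed (Suc l)\<close> the one just after; they differ in mode \<open>l\<close>
    only.\<close>
  let ?X = "mixed l (P (Suc j)) (P j)" and ?Y = "mixed (Suc l) (P (Suc j)) (P j)"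
  have "Re (mat_inner (grad t k B l ?X) (?Y l - ?X l)) \<le> objective t k B ?Y - objective t k B ?X"
    using l P_carrier[OF l] by (intro objective_increment) (auto simp: mixed_def)
  moreover have "grad t k B l ?X = P (Suc j) l * Lam j l"
    using Hhat[OF l] Hhat_polar(1)[OF l] by simp
  moreover have "?Y l - ?X l = P (Suc j) l - P j l" by (simp add: mixed_def)
  ultimately show ?thesis
    using polar_increment[OF P_stiefel[OF l] P_stiefel[OF l] Hhat_polar(2,3)[OF l], of "Suc j" j j]
    by (simp add: defect_def)
qed

text \<open>A sweep consists of \<open>m\<close> updates, none of which lowers the objective, so a
  single update gains at most as much as the sweep.\<close>

lemma defect_le_gain:
  assumes l: "l < m"
  shows "defect j l \<le> 2 * gain j"
proof -
  let ?F = "\<lambda>i. objective t k B (mixed i (P (Suc j)) (P j))"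
  have step: "?F i \<le> ?F (Suc i)" if "i < m" for i
    using defect_le_stage_increment[OF that] defect_nonneg[OF that] by (smt (verit))
  have up: "?F a \<le> ?F b" if "a \<le> b" "b \<le> m" for a b
    using that by (induction b rule: dec_induct) (auto intro: order_trans[OF _ step])
  have "?F (Suc l) \<le> ?F m" "?F 0 \<le> ?F l" using l by (auto intro!: up)
  moreover have "?F m = objective t k B (P (Suc j))" by (rule objective_cong) (simp add: mixed_def)
  moreover have "?F 0 = objective t k B (P j)" by (simp add: mixed_def)
  ultimately show ?thesis
    using defect_le_stage_increment[OF l, of j] by (simp add: gain_def)
qed

lemma incseq_objective:
  assumes "0 < m"
  shows "incseq (\<lambda>j. objective t k B (P j))"
  using defect_le_gain[OF assms] defect_nonneg[OF assms]
  by (intro incseq_SucI) (smt (verit) gain_def)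

lemma convergent_objective:
  assumes m: "0 < m"
  shows "convergent (\<lambda>j. objective t k B (P j))"
proof -
  obtain r :: "nat \<Rightarrow> nat" and Y where r: "strict_mono r" "tuple_LIMSEQ m (\<lambda>i. P (r i)) Y"
    using stiefel_tuple_subseq[of m P K n] P_stiefel by blast
  have "Y l \<in> carrier_mat (n l) (K l)" if "l < m" for l
    using mat_LIMSEQ_carrier_limit[of "\<lambda>i. P (r i) l", OF _ P_carrier[OF that]] r(2) that
    by (simp add: tuple_LIMSEQ_def)
  then have "(\<lambda>i. objective t k B (P (r i))) \<longlonglongrightarrow> objective t k B Y"
    using r(2) by (intro objective_LIMSEQ) auto
  moreover have inc: "incseq (\<lambda>i. objective t k B (P (r i)))"
    using incseq_objective[OF m] r(1) by (simp add: incseq_def strict_mono_less_eq)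
  ultimately have "objective t k B (P (r i)) \<le> objective t k B Y" for i
    using incseq_le by blast
  \<comment> \<open>Since \<open>j \<le> r j\<close>, monotonicity extends the bound from the
    subsequence to the whole sequence.\<close>
  then have "objective t k B (P j) \<le> objective t k B Y" for j
    using incseqD[OF incseq_objective[OF m] seq_suble[OF r(1), of j]] order_trans by blast
  then show ?thesis
    using incseq_convergent[OF incseq_objective[OF m]] by (metis convergentI)
qed

lemma summable_gain:
  assumes "0 < m"
  shows "summable gain"
proof -
  have "(\<lambda>j. objective t k B (P j)) \<longlonglongrightarrow> lim (\<lambda>j. objective t k B (P j))"
    using convergent_objective[OF assms] by (simp add: convergent_LIMSEQ_iff)
  then show ?thesis
    using telescope_summable unfolding gain_def by blast
qed

lemma defect_LIMSEQ:
  assumes "l < m" "strict_mono (r :: nat \<Rightarrow> nat)"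
  shows "(\<lambda>i. defect (r i) l) \<longlonglongrightarrow> 0"
proof (rule LIMSEQ_0_comparison)
  have "0 < m" using assms by simp
  then have "(\<lambda>j. 2 * gain j) \<longlonglongrightarrow> 2 * 0"
    using summable_LIMSEQ_zero[OF summable_gain] by (intro tendsto_mult tendsto_const)
  then show "(\<lambda>i. 2 * gain (r i)) \<longlonglongrightarrow> 0"
    using LIMSEQ_subseq_LIMSEQ[OF _ assms(2)] by (fastforce simp: o_def)
qed (use assms defect_le_gain defect_nonneg in auto)

section \<open>Limits along subsequences\<close>

lemma limit_carrier:
  assumes "tuple_LIMSEQ m' (\<lambda>i. P (r i)) Y" "m' \<le> m" "l < m'"
  shows "Y l \<in> carrier_mat (n l) (K l)"
  using assms mat_LIMSEQ_carrier_limit[of "\<lambda>i. P (r i) l", OF _ P_carrier]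
  by (simp add: tuple_LIMSEQ_def)

lemma Hhat_LIMSEQ:
  assumes l: "l < m" and Ps: "tuple_LIMSEQ m (\<lambda>i. P (r i)) Ps"
    and Phat: "tuple_LIMSEQ l (\<lambda>i. P (Suc (r i))) Phat"
  shows "mat_LIMSEQ (\<lambda>i. Hhat (r i) l) (grad t k B l (mixed l Phat Ps))"
proof -
  have "tuple_LIMSEQ m (\<lambda>i. mixed l (P (Suc (r i))) (P (r i))) (mixed l Phat Ps)"
    using l Ps Phat by (auto simp: tuple_LIMSEQ_def mixed_def)
  moreover have "mixed l Phat Ps i \<in> carrier_mat (n i) (K i)" if "i < m" for i
    using limit_carrier[OF Ps _ that] limit_carrier[OF Phat, of i] l that by (auto simp: mixed_def)
  ultimately show ?thesis
    unfolding Hhat[OF l] using l by (intro grad_LIMSEQ) auto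
qed

text \<open>New factors are required to converge only below \<open>l\<close>, since only those enter
  the gradient for mode \<open>l\<close>. This form serves both an arbitrary limit
  \<open>Phat\<close> and the induction over modes.\<close>

lemma step_limit:
  assumes l: "l < m" and r: "strict_mono r" and Ps: "tuple_LIMSEQ m (\<lambda>i. P (r i)) Ps"
    and Phat: "tuple_LIMSEQ l (\<lambda>i. P (Suc (r i))) Phat"
  defines "G \<equiv> grad t k B l (mixed l Phat Ps)"
  shows "G = Ps l * (mat_adjoint (Ps l) * G)" "psd_mat (mat_adjoint (Ps l) * G)"
    "vec_space.rank (n l) G = K l \<Longrightarrow> mat_LIMSEQ (\<lambda>i. P (Suc (r i)) l) (Ps l)"
proof -
  have P_lim: "mat_LIMSEQ (\<lambda>i. P (r i) l) (Ps l)" using Ps l by (simp add: tuple_LIMSEQ_def)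
  have H_lim: "mat_LIMSEQ (\<lambda>i. P (Suc (r i)) l * Lam (r i) l) G"
    using Hhat_LIMSEQ[OF l Ps Phat] Hhat_polar(1)[OF l] by (simp add: G_def)
  note lim = polar_limit[where Q = "\<lambda>i. P (Suc (r i)) l" and L = "\<lambda>i. Lam (r i) l",
    OF P_stiefel[OF l] P_stiefel[OF l] Hhat_polar(2,3)[OF l] P_lim H_lim
    defect_LIMSEQ[OF l r, unfolded defect_def]]
  show "G = Ps l * (mat_adjoint (Ps l) * G)" "psd_mat (mat_adjoint (Ps l) * G)"
    "vec_space.rank (n l) G = K l \<Longrightarrow> mat_LIMSEQ (\<lambda>i. P (Suc (r i)) l) (Ps l)"
    using lim by blast+
qed

text \<open>Strong induction on the mode: when the new factors below \<open>l\<close> tend to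
  \<open>Ps\<close>, the mixed limit tuple is \<open>Ps\<close>, so the rank hypothesis concerns the
  actual limit of the gradients and settles mode \<open>l\<close>.\<close>

lemma next_LIMSEQ:
  assumes r: "strict_mono r" and Ps: "tuple_LIMSEQ m (\<lambda>i. P (r i)) Ps"
    and rank: "\<And>i. i < l' \<Longrightarrow> vec_space.rank (n i) (grad t k B i Ps) = K i" and l': "l' \<le> m"
  shows "tuple_LIMSEQ l' (\<lambda>i. P (Suc (r i))) Ps"
proof -
  have "mat_LIMSEQ (\<lambda>i. P (Suc (r i)) l) (Ps l)" if "l < l'" for l
    using that
  proof (induction l rule: less_induct)
    case (less l)
    then have "tuple_LIMSEQ l (\<lambda>i. P (Suc (r i))) Ps" by (simp add: tuple_LIMSEQ_def)
    moreover have "mixed l Ps Ps = Ps" by (simp add: mixed_def)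
    ultimately show ?case
      using step_limit(3)[OF _ r Ps, of l Ps] rank less.prems l' by simp
  qed
  then show ?thesis by (simp add: tuple_LIMSEQ_def)
qed

text \<open>Refining \<open>r\<close> by \<open>q\<close> makes the new factors converge too. The
  \<open>m - 1\<close> modes of \<open>Phat\<close> suffice, as mode \<open>l\<close> uses only new
  factors below \<open>l \<le> m - 1\<close>.\<close>

lemma limit_polar:
  assumes l: "l < m" and r: "strict_mono r" and Ps: "tuple_LIMSEQ m (\<lambda>i. P (r i)) Ps"
    and Phat: "accumulation_point (m - 1) (\<lambda>i. P (Suc (r i))) Phat"
  defines "G \<equiv> grad t k B l (mixed l Phat Ps)"
  shows "G = Ps l * (mat_adjoint (Ps l) * G)" "psd_mat (mat_adjoint (Ps l) * G)"
proof -
  obtain q :: "nat \<Rightarrow> nat" where q: "strict_mono q" "tuple_LIMSEQ (m - 1) (\<lambda>i. P (Suc (r (q i)))) Phat"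
    using Phat by (auto simp: accumulation_point_def)
  have "tuple_LIMSEQ m (\<lambda>i. P ((r \<circ> q) i)) Ps"
    using Ps mat_LIMSEQ_subseq[OF _ q(1)] by (auto simp: tuple_LIMSEQ_def)
  moreover have "tuple_LIMSEQ l (\<lambda>i. P (Suc ((r \<circ> q) i))) Phat"
    using q(2) l by (simp add: tuple_LIMSEQ_def)
  ultimately show "G = Ps l * (mat_adjoint (Ps l) * G)" "psd_mat (mat_adjoint (Ps l) * G)"
    unfolding G_def using step_limit(1,2)[OF l strict_mono_o[OF r q(1)]] by blast+
qed

lemma limit_condition_K:
  assumes r: "strict_mono r" and Ps: "tuple_LIMSEQ m (\<lambda>i. P (r i)) Ps"
    and Phat: "accumulation_point (m - 1) (\<lambda>i. P (Suc (r i))) Phat"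
    and eq: "\<And>l. l < m - 1 \<Longrightarrow> Phat l = Ps l"
  shows "condition_K t k B Ps"
proof -
  have "grad t k B l (mixed l Phat Ps) = grad t k B l Ps" if "l < m" for l
    using that eq by (intro grad_cong) (auto simp: mixed_def)
  then show ?thesis
    using limit_polar[OF _ r Ps Phat] by (auto simp: condition_K_def Let_def)
qed

text \<open>The orthonormality of the columns passes to the limit, and the multiplier in (K), being
  positive semidefinite, is Hermitian.\<close>

lemma limit_KKT:
  assumes r: "strict_mono r" and Ps: "tuple_LIMSEQ m (\<lambda>i. P (r i)) Ps"
    and K: "condition_K t k B Ps"
  shows "KKT_condition t k B Ps"
  unfolding KKT_condition_def
proof (intro allI impI conjI)
  fix l assume "l < length (tdims B)"
  then have l: "l < m" by simp
  have "mat_LIMSEQ (\<lambda>i. P (r i) l) (Ps l)" using Ps l by (simp add: tuple_LIMSEQ_def)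
  then show "Ps l \<in> stiefel (K l) (tdims B ! l)"
    using stiefel_LIMSEQ[OF _ P_stiefel[OF l]] l by auto
  then have c: "Ps l \<in> carrier_mat (n l) (K l)" using l by (simp add: stiefel_iff)
  then have "mat_adjoint (Ps l) * grad t k B l Ps \<in> carrier_mat (K l) (K l)"
    using l by (auto intro!: mult_carrier_mat[of _ _ "n l"] grad_carrier[of l B Ps, simplified])
  then show "\<exists>L\<in>carrier_mat (K l) (K l). hermitian_mat L \<and> grad t k B l Ps = Ps l * L"
    using K l by (intro bexI[of _ "mat_adjoint (Ps l) * grad t k B l Ps"])
      (auto simp: condition_K_def Let_def psd_mat_def)
qed

text \<open>Full rank makes the new factors converge to \<open>Ps\<close> along all of
  \<open>r\<close>, so every accumulation point of them has the same components.\<close>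

lemma full_rank_limit_eq:
  assumes r: "strict_mono r" and Ps: "tuple_LIMSEQ m (\<lambda>i. P (r i)) Ps"
    and Phat: "accumulation_point (m - 1) (\<lambda>i. P (Suc (r i))) Phat"
    and rank: "\<And>l. l < m - 1 \<Longrightarrow> vec_space.rank (n l) (grad t k B l Ps) = K l"
    and l: "l < m - 1"
  shows "Phat l = Ps l"
proof -
  obtain q :: "nat \<Rightarrow> nat" where q: "strict_mono q" "tuple_LIMSEQ (m - 1) (\<lambda>i. P (Suc (r (q i)))) Phat"
    using Phat by (auto simp: accumulation_point_def)
  have "tuple_LIMSEQ (m - 1) (\<lambda>i. P (Suc (r i))) Ps"
    by (rule next_LIMSEQ[OF r Ps rank]) auto
  then have "mat_LIMSEQ (\<lambda>i. P (Suc (r i)) l) (Ps l)" using l by (simp add: tuple_LIMSEQ_def)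
  then have "mat_LIMSEQ (\<lambda>i. P (Suc (r (q i))) l) (Ps l)" by (rule mat_LIMSEQ_subseq[OF _ q(1)])
  moreover have "mat_LIMSEQ (\<lambda>i. P (Suc (r (q i))) l) (Phat l)" using q(2) l by (simp add: tuple_LIMSEQ_def)
  ultimately show ?thesis using mat_LIMSEQ_unique by blast
qed

text \<open>If the sequence left a small neighbourhood of \<open>Ps\<close> infinitely often, the exit indices
  would accumulate inside the neighbourhood, hence at \<open>Ps\<close> by isolation; but from there the
  next iterate also tends to \<open>Ps\<close>.\<close>

lemma isolated_limit:
  assumes iso: "isolated_accumulation_point m P Ps"
    and rank: "\<And>l. l < m \<Longrightarrow> vec_space.rank (n l) (grad t k B l Ps) = K l"
  shows "tuple_LIMSEQ m P Ps"
proof (rule ccontr)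
  assume not: "\<not> tuple_LIMSEQ m P Ps"
  obtain \<epsilon> r where r: "strict_mono r" "tuple_LIMSEQ m (\<lambda>i. P (r i)) Ps" and \<epsilon>: "0 < \<epsilon>"
    "\<And>Q. accumulation_point m P Q \<Longrightarrow> (\<forall>l<m. frob_norm (Q l - Ps l) < \<epsilon>) \<Longrightarrow> \<forall>l<m. Q l = Ps l"
    using iso unfolding isolated_accumulation_point_def accumulation_point_def by blast
  have Ps: "Ps l \<in> carrier_mat (n l) (K l)" if "l < m" for l
    using limit_carrier[OF r(2) order_refl that] .
  define d where "d X = (\<Sum>l<m. frob_norm (X l - Ps l))" for X
  have d_nonneg: "0 \<le> d X" for X by (simp add: d_def sum_nonneg)
  have d_norm: "norm (d X - 0) = d X" for X using d_nonneg[of X] by simp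
  have d_ge: "frob_norm (X l - Ps l) \<le> d X" if "l < m" for X l
    unfolding d_def using that by (intro member_le_sum) auto
  have d_lim: "(\<lambda>i. d (X i)) \<longlonglongrightarrow> d Y"
    if "tuple_LIMSEQ m X Y" "\<And>l. l < m \<Longrightarrow> Y l \<in> carrier_mat (n l) (K l)" for X Y
    unfolding d_def using that Ps
    by (intro tendsto_sum mat_LIMSEQ_frob_norm mat_LIMSEQ_diff mat_LIMSEQ_const)
      (use that carrier_matD[OF Ps] carrier_matD[OF that(2)] in \<open>auto simp: tuple_LIMSEQ_def\<close>)
  have d_Ps: "d Ps = 0"
    using Ps by (auto simp: d_def frob_norm_def)
  have "\<not> (\<lambda>j. d (P j)) \<longlonglongrightarrow> 0"
  proof
    assume lim: "(\<lambda>j. d (P j)) \<longlonglongrightarrow> 0"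
    have "mat_LIMSEQ (\<lambda>j. P j l) (Ps l)" if l: "l < m" for l
    proof -
      have "(\<lambda>j. frob_norm (P j l - Ps l)) \<longlonglongrightarrow> 0"
        by (rule LIMSEQ_0_comparison[OF lim d_ge[OF l]]) simp
      then show ?thesis
        using P_carrier[OF l] carrier_matD[OF Ps[OF l]] by (simp add: mat_LIMSEQ_def)
    qed
    then show False using not by (simp add: tuple_LIMSEQ_def)
  qed
  then obtain e where e: "0 < e" "\<And>N. \<exists>j\<ge>N. e \<le> d (P j)"
    unfolding LIMSEQ_iff d_norm by (meson not_less)
  \<comment> \<open>\<open>\<eta> \<le> e\<close> keeps iterates at distance at least
    \<open>\<eta>\<close> arbitrarily late. Halving \<open>\<epsilon>\<close> leaves room for the
    limit of iterates closer than \<open>\<eta>\<close>, which may itself be at distance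
    \<open>\<eta>\<close>.\<close>
  define \<eta> where "\<eta> = min e (\<epsilon> / 2)"
  have \<eta>: "0 < \<eta>" "\<eta> \<le> e" "\<eta> < \<epsilon>" using e(1) \<epsilon>(1) by (auto simp: \<eta>_def)
  define E where "E = {j. d (P j) < \<eta> \<and> \<eta> \<le> d (P (Suc j))}"
  have "\<exists>j\<ge>N. j \<in> E" for N
  proof -
    have "(\<lambda>i. d (P (r i))) \<longlonglongrightarrow> 0" using d_lim[OF r(2) Ps] d_Ps by simp
    then obtain N' where "\<And>i. N' \<le> i \<Longrightarrow> d (P (r i)) < \<eta>"
      unfolding LIMSEQ_iff d_norm using \<eta>(1) by blast
    then have a: "d (P (r (max N N'))) < \<eta>" by simp
    define a where "a = r (max N N')"
    have "N \<le> a" using seq_suble[OF r(1), of "max N N'"] by (simp add: a_def)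
    obtain b where "a \<le> b" "\<eta> \<le> d (P b)" using e(2)[of a] \<eta>(2) order_trans by blast
    \<comment> \<open>Walking from \<open>a\<close>, which is near, to \<open>b\<close>, which is
      far: either the predecessor of \<open>b\<close> is far too and the induction hypothesis
      applies, or it is itself an exit index.\<close>
    then have "\<exists>j. a \<le> j \<and> j \<in> E"
    proof (induction b rule: dec_induct)
      case base
      then show ?case using a by (simp add: a_def)
    next
      case (step b)
      then show ?case by (cases "\<eta> \<le> d (P b)") (auto simp: E_def)
    qed
    then show ?thesis using \<open>N \<le> a\<close> order_trans by blast
  qed
  then have inf: "infinite E" unfolding infinite_nat_iff_unbounded_le by blast
  define p where "p = enumerate E"
  have p: "strict_mono p" unfolding p_def by (rule strict_mono_enumerate[OF inf])
  have pE: "p i \<in> E" for i unfolding p_def by (rule enumerate_in_set[OF inf])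
  obtain q :: "nat \<Rightarrow> nat" and Y where q: "strict_mono q" "tuple_LIMSEQ m (\<lambda>i. P (p (q i))) Y"
    using stiefel_tuple_subseq[of m "\<lambda>i. P (p i)" K n] P_stiefel by blast
  have Y: "Y l \<in> carrier_mat (n l) (K l)" if "l < m" for l
    using limit_carrier[OF q(2) order_refl that] .
  have pq: "strict_mono (\<lambda>i. p (q i))" using p q(1) by (simp add: strict_mono_def)
  have "d Y \<le> \<eta>"
    using pE by (intro LIMSEQ_le_const2[OF d_lim[OF q(2) Y]]) (auto simp: E_def intro: less_imp_le)
  then have "\<forall>l<m. frob_norm (Y l - Ps l) < \<epsilon>"
    using d_ge[of _ Y] \<eta>(3) by (meson le_less_trans)
  moreover have "accumulation_point m P Y"
    using q(2) pq by (auto simp: accumulation_point_def)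
  ultimately have "\<forall>l<m. Y l = Ps l" using \<epsilon>(2) by blast
  then have "tuple_LIMSEQ m (\<lambda>i. P (p (q i))) Ps" using q(2) by (simp add: tuple_LIMSEQ_def)
  then have "tuple_LIMSEQ m (\<lambda>i. P (Suc (p (q i)))) Ps"
    by (rule next_LIMSEQ[OF pq _ rank order_refl])
  from d_lim[OF this Ps] have "(\<lambda>i. d (P (Suc (p (q i))))) \<longlonglongrightarrow> 0" by (simp add: d_Ps)
  then have "\<eta> \<le> 0"
    using pE by (intro LIMSEQ_le_const[of _ 0]) (auto simp: E_def)
  then show False using \<eta>(1) by simp
qed

section \<open>The two convergent series\<close>

lemma sigma_min_step_le:
  assumes l: "l < m"
  shows "sigma_min (Hhat j l) * (frob_norm (P (Suc j) l - P j l * (mat_adjoint (P j l) * P (Suc j) l)))\<^sup>2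
      \<le> 2 * gain j" (is "?s * ?x\<^sup>2 \<le> _")
    and "0 \<le> sigma_min (Hhat j l)"
proof -
  show 0: "0 \<le> ?s" by (rule sigma_min_nonneg[OF Hhat_carrier[OF l] k_le[OF l] K_pos[OF l]])
  have "?x \<le> frob_norm (P (Suc j) l - P j l)"
    by (rule projection_defect_le[OF P_stiefel[OF l] P_stiefel[OF l]])
  then have "?s * ?x\<^sup>2 \<le> ?s * (frob_norm (P (Suc j) l - P j l))\<^sup>2"
    using 0 by (intro mult_left_mono power_mono) auto
  also have "\<dots> \<le> defect j l"
    unfolding defect_def Hhat_polar(1)[OF l]
    by (rule sigma_min_polar_bound[OF P_stiefel[OF l] Hhat_polar(2,3)[OF l] k_le[OF l] minus_carrier_mat[OF P_carrier[OF l]]])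
  finally show "?s * ?x\<^sup>2 \<le> 2 * gain j" using defect_le_gain[OF l, of j] by linarith
qed

lemma summable_le_gain:
  assumes "0 < m" "\<And>j. 0 \<le> f j" "\<And>j. f j \<le> 2 * gain j"
  shows "summable f"
proof (rule summable_comparison_test')
  show "summable (\<lambda>j. 2 * gain j)" by (rule summable_mult[OF summable_gain[OF assms(1)]])
  show "norm (f j) \<le> 2 * gain j" for j using assms(2,3)[of j] by simp
qed

lemma summable_sin_Theta:
  assumes l: "l < m"
  shows "summable (\<lambda>j. sigma_min (Hhat j l) *
    (frob_norm (sin_Theta (n l) (vec_space.col_space (n l) (P (Suc j) l))
      (vec_space.col_space (n l) (P j l))))\<^sup>2)"
  unfolding frob_norm_sin_Theta_sq[OF P_stiefel[OF l] P_stiefel[OF l]]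
proof (rule summable_le_gain)
  show "0 < m" using l by simp
qed (use sigma_min_step_le[OF l] in simp_all)

text \<open>By \<open>polar_residual_le\<close> the quotient is at most the squared projection
  residual of the new factor, so the majorant \<open>2 * gain j\<close> of the first series works
  here as well.\<close>

lemma summable_residual:
  assumes l: "l < m"
  shows "summable (\<lambda>j. sigma_min (Hhat j l) *
    ((frob_norm (Hhat j l - P j l * (mat_adjoint (P j l) * Hhat j l)))\<^sup>2 / (frob_norm (Hhat j l))\<^sup>2))"
proof (rule summable_le_gain)
  fix j
  have "(frob_norm (Hhat j l - P j l * (mat_adjoint (P j l) * Hhat j l)))\<^sup>2 / (frob_norm (Hhat j l))\<^sup>2
      \<le> (frob_norm (P (Suc j) l - P j l * (mat_adjoint (P j l) * P (Suc j) l)))\<^sup>2"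
    using polar_residual_le[OF P_stiefel[OF l] P_stiefel[OF l] Hhat_polar(3)[OF l], of "Suc j" j j]
    by (simp flip: Hhat_polar(1)[OF l])
  then show "sigma_min (Hhat j l) * ((frob_norm (Hhat j l - P j l * (mat_adjoint (P j l) * Hhat j l)))\<^sup>2
      / (frob_norm (Hhat j l))\<^sup>2) \<le> 2 * gain j"
    using sigma_min_step_le[OF l, of j] by (meson mult_left_mono order_trans)
qed (use l sigma_min_step_le(2)[OF l] in auto)

end


theorem theorem4p1:
  fixes m t :: nat
    and n :: "nat \<Rightarrow> nat"
    and k :: "nat \<Rightarrow> nat \<Rightarrow> nat"
    and B :: ctensor
    and P :: "nat \<Rightarrow> nat \<Rightarrow> complex mat"
    and Hhat :: "nat \<Rightarrow> nat \<Rightarrow> complex mat"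
  assumes m: "m \<ge> 2" and t: "t \<ge> 1"
    and dims: "tdims B = map n [0..<m]"
    and k_pos: "\<And>l s. l < m \<Longrightarrow> s < t \<Longrightarrow> k l s \<ge> 1"
    and k_le: "\<And>l. l < m \<Longrightarrow> (\<Sum>s<t. k l s) \<le> n l"
    and init: "\<And>l. l < m \<Longrightarrow> P 0 l \<in> stiefel (\<Sum>s<t. k l s) (n l)"
    and Hhat: "\<And>j l. l < m \<Longrightarrow> Hhat j l = grad t k B l (mixed l (P (Suc j)) (P j))"
    and iter: "\<And>j l. l < m \<Longrightarrow> orthonormal_polar_factor (P (Suc j) l) (Hhat j l)"
  shows
    "(incseq (\<lambda>j. objective t k B (P j)) \<and> convergent (\<lambda>j. objective t k B (P j)))
   \<and> (\<forall>(Ps :: nat \<Rightarrow> complex mat) (r :: nat \<Rightarrow> nat) (Phat :: nat \<Rightarrow> complex mat).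
        strict_mono r \<and> tuple_LIMSEQ m (\<lambda>i. P (r i)) Ps \<and>
        accumulation_point (m - 1) (\<lambda>i. P (Suc (r i))) Phat \<longrightarrow>
          ((\<forall>l<m. let Hs = grad t k B l (mixed l Phat Ps); L = mat_adjoint (Ps l) * Hs
                  in Hs = Ps l * L \<and> psd_mat L)
           \<and> ((\<forall>l<m-1. Phat l = Ps l) \<longrightarrow> condition_K t k B Ps))
        \<and> ((\<forall>l<m-1. vec_space.rank (n l) (grad t k B l Ps) = (\<Sum>s<t. k l s)) \<longrightarrow>
             (\<forall>l<m-1. Phat l = Ps l) \<and> KKT_condition t k B Ps \<and> condition_K t k B Ps)
        \<and> (isolated_accumulation_point m P Ps \<and>
           (\<forall>l<m. vec_space.rank (n l) (grad t k B l Ps) = (\<Sum>s<t. k l s)) \<longrightarrow>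
             tuple_LIMSEQ m P Ps))
   \<and> (\<forall>l<m.
        summable (\<lambda>j. sigma_min (Hhat j l) *
          (frob_norm (sin_Theta (n l) (vec_space.col_space (n l) (P (Suc j) l))
                                      (vec_space.col_space (n l) (P j l))))\<^sup>2)
      \<and> summable (\<lambda>j. sigma_min (Hhat j l) *
          ((frob_norm (Hhat j l - P j l * (mat_adjoint (P j l) * Hhat j l)))\<^sup>2
            / (frob_norm (Hhat j l))\<^sup>2)))"


proof -
  interpret alternating_npdo m t n k B P Hhat
    by unfold_locales (use t dims k_pos k_le init Hhat iter in auto)
  have m0: "0 < m" using m by simp
  show ?thesis
    using incseq_objective[OF m0] convergent_objective[OF m0] summable_sin_Theta summable_residual
      limit_polar limit_condition_K full_rank_limit_eq limit_KKT isolated_limit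
    by (auto simp: Let_def)
qed

end
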